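(* Let $G=(V,E)$ be a connected cograph of size $n>1$ with $V=\{1,\dots,n\}$, and let $\pi_{\mathrm{sib}}(G)=\{\mathbf C_1,\dots,\mathbf C_p\}$ be its sibling partition, with $|\mathbf C_i|=m_i$ for $1\le i\le p$. Consider the network with Laplacian dynamics $\dot x=-L(G)x+Bu$ and input matrix $B=[e_{j_1},\dots,e_{j_m}]$, with set of control nodes $V_C=\{j_1,\dots,j_m\}\subseteq V$. Then the minimum number $|V_C|$ of control nodes rendering the network controllable is $n-p$. Moreover, a set $V_C$ of $n-p$ control nodes renders the network controllable if and only if it is obtained by selecting exactly $m_i-1$ nodes from each cell $\mathbf C_i$, $1\le i\le p$.
   Context: Graphs are finite, simple, unweighted, undirected. $L(G)=\Delta(G)-A(G)$ is the Laplacian (degree matrix minus adjacency matrix), and $e_j$ is the $j$-th column of the $n\times n$ identity matrix. The network $\dot x=Ax+Bu$ is controllable if the pair $(A,B)$ is controllable, i.e. the input can steer the state from any initial value to any final value in finite time. The union $G_1+G_2$ of disjoint graphs has the union of the node sets and of the edge sets; the join $G_1*G_2$ additionally contains all edges between the nodes of $G_1$ and the nodes of $G_2$. Cographs are the graphs obtained from single nodes by repeatedly taking unions and joins. Cotree: the cotree of a cograph $G$ is the (unique) rooted tree whose leaves are the nodes of $G$, in which every internal (non-leaf) node has at least two children and a label in $\{0,1\}$, labels alternate along every path of internal nodes from the root, and such that for each internal node $z$ the subgraph of $G$ induced on the leaves descending from $z$ is the union (label $0$) or the join (label $1$) of the subgraphs induced on the leaves descending from each child of $z$. Two nodes of $G$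 are siblings if the corresponding leaves of the cotree have the same parent. The sibling partition $\pi_{\mathrm{sib}}(G)$ is the partition of $V$ into cells such that two nodes are in the same cell if and only if they are siblings. *)

theory Defs
  imports
    Complex_Main
    "HOL-Library.FSet"
    "HOL-Library.Disjoint_Sets"
    "Graph_Theory.Graph_Theory"
    "Jordan_Normal_Form.Matrix"
begin

section \<open>Unions, joins and cographs\<close>

text \<open>
  An undirected edge between \<open>u\<close> and \<open>v\<close> is represented by the two arcs \<open>(u,v)\<close> and \<open>(v,u)\<close>;
  a finite simple undirected graph is a \<^locale>\<open>pair_graph\<close>.
\<close>

definition graph_union :: "'a pair_pre_digraph set \<Rightarrow> 'a pair_pre_digraph" where
  "graph_union \<G> = \<lparr> pverts = (\<Union>G\<in>\<G>. pverts G), parcs = (\<Union>G\<in>\<G>. parcs G) \<rparr>"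

definition graph_join :: "'a pair_pre_digraph set \<Rightarrow> 'a pair_pre_digraph" where
  "graph_join \<G> =
     \<lparr> pverts = (\<Union>G\<in>\<G>. pverts G),
       parcs = (\<Union>G\<in>\<G>. parcs G) \<union> (\<Union>G\<in>\<G>. \<Union>H\<in>\<G> - {G}. pverts G \<times> pverts H) \<rparr>"

inductive cograph :: "'a pair_pre_digraph \<Rightarrow> bool" where
  node: "cograph \<lparr> pverts = {v}, parcs = {} \<rparr>"
| union: "cograph (graph_union {G, H})"
    if "cograph G" "cograph H" "pverts G \<inter> pverts H = {}"
| join: "cograph (graph_join {G, H})"
    if "cograph G" "cograph H" "pverts G \<inter> pverts H = {}"

definition induced :: "'a pair_pre_digraph \<Rightarrow> 'a set \<Rightarrow> 'a pair_pre_digraph" where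
  "induced G S = \<lparr> pverts = S, parcs = parcs G \<inter> S \<times> S \<rparr>"


section \<open>Cotrees and the sibling partition\<close>

datatype label = Label0 | Label1

text \<open>
  The children of a node form a finite set, so that trees differing only in the order of
  children are equal and the cotree is unique on the nose.  No child is lost by this:
  distinct children of a cotree node have disjoint, nonempty sets of leaves.
\<close>

datatype (leaves: 'a) ltree = Leaf 'a | Node label "'a ltree fset"

primrec subtrees :: "'a ltree \<Rightarrow> 'a ltree set" where
  "subtrees (Leaf v) = {Leaf v}"
| "subtrees (Node b ts) = insert (Node b ts) (\<Union> (fset (fimage subtrees ts)))"

definition is_cotree :: "'a pair_pre_digraph \<Rightarrow> 'a ltree \<Rightarrow> bool" where
  "is_cotree G T \<longleftrightarrow>
     leaves T = pverts G \<and>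
     (\<forall>b ts. Node b ts \<in> subtrees T \<longrightarrow>
        2 \<le> fcard ts \<and>
        disjoint_family_on leaves (fset ts) \<and>
        (\<forall>c us. Node c us \<in> fset ts \<longrightarrow> c \<noteq> b) \<and>
        induced G (leaves (Node b ts)) =
          (case b of Label0 \<Rightarrow> graph_union | Label1 \<Rightarrow> graph_join)
            ((\<lambda>t. induced G (leaves t)) ` fset ts))"

definition cotree :: "'a pair_pre_digraph \<Rightarrow> 'a ltree" where
  "cotree G = (THE T. is_cotree G T)"

definition siblings :: "'a pair_pre_digraph \<Rightarrow> 'a \<Rightarrow> 'a \<Rightarrow> bool" where
  "siblings G u v \<longleftrightarrow>
     (\<exists>b ts. Node b ts \<in> subtrees (cotree G) \<and> Leaf u \<in> fset ts \<and> Leaf v \<in> fset ts)"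

text \<open>The disjunct \<open>u = v\<close> only matters for the one-node graph, whose leaf has no parent.\<close>

definition sibling_partition :: "'a pair_pre_digraph \<Rightarrow> 'a set set" where
  "sibling_partition G =
     pverts G // {(u, v) \<in> pverts G \<times> pverts G. u = v \<or> siblings G u v}"


section \<open>Laplacian dynamics\<close>

text \<open>
  The nodes are \<open>1, \<dots>, n\<close>, whereas vector and matrix indices start at \<open>0\<close>:
  node \<open>i\<close> corresponds to index \<open>i - 1\<close>.
\<close>

definition degree_matrix :: "nat \<Rightarrow> nat pair_pre_digraph \<Rightarrow> real mat" where
  "degree_matrix n G =
     mat n n (\<lambda>(i, j). if i = j then real (out_degree (with_proj G) (Suc i)) else 0)"

definition adjacency_matrix :: "nat \<Rightarrow> nat pair_pre_digraph \<Rightarrow> real mat" where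
  "adjacency_matrix n G = mat n n (\<lambda>(i, j). if (Suc i, Suc j) \<in> parcs G then 1 else 0)"

definition laplacian :: "nat \<Rightarrow> nat pair_pre_digraph \<Rightarrow> real mat" where
  "laplacian n G = degree_matrix n G - adjacency_matrix n G"

definition input_matrix :: "nat \<Rightarrow> nat list \<Rightarrow> real mat" where
  "input_matrix n js = mat_of_cols n (map (\<lambda>j. unit_vec n (j - 1)) js)"


section \<open>Controllability of linear systems\<close>

text \<open>
  \<open>x\<close> is a solution on \<open>[0, T]\<close> of \<open>x' = A x + B u\<close> for the continuous input \<open>u\<close>.
  Continuity and derivatives are taken componentwise, as \<^typ>\<open>real vec\<close> carries no topology.
\<close>

definition trajectory ::
  "real mat \<Rightarrow> real mat \<Rightarrow> real \<Rightarrow> (real \<Rightarrow> real vec) \<Rightarrow> (real \<Rightarrow> real vec) \<Rightarrow> bool" where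
  "trajectory A B T u x \<longleftrightarrow>
     (\<forall>t\<in>{0..T}. u t \<in> carrier_vec (dim_col B) \<and> x t \<in> carrier_vec (dim_row A)) \<and>
     (\<forall>j<dim_col B. continuous_on {0..T} (\<lambda>t. u t $ j)) \<and>
     (\<forall>t\<in>{0..T}. \<forall>i<dim_row A.
        ((\<lambda>s. x s $ i) has_real_derivative (A *\<^sub>v x t + B *\<^sub>v u t) $ i) (at t within {0..T}))"

definition controllable :: "real mat \<Rightarrow> real mat \<Rightarrow> bool" where
  "controllable A B \<longleftrightarrow>
     (\<forall>x0\<in>carrier_vec (dim_row A). \<forall>x1\<in>carrier_vec (dim_row A).
        \<exists>T>0. \<exists>u x. trajectory A B T u x \<and> x 0 = x0 \<and> x T = x1)"

definition network_controllable :: "nat \<Rightarrow> nat pair_pre_digraph \<Rightarrow> nat list \<Rightarrow> bool" where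
  "network_controllable n G js \<longleftrightarrow> controllable (- laplacian n G) (input_matrix n js)"

end

theory Submission
  imports Defs "Jordan_Normal_Form.Determinant"
begin

text \<open>
  If two siblings \<open>u\<close> and \<open>v\<close> are both uncontrolled, \<open>x\<^sub>u - x\<^sub>v\<close> satisfies a scalar linear equation
  without input, so the network is not controllable.  Conversely, if every cell of the sibling
  partition has at most one uncontrolled node, an induction over the cotree shows that a set of
  vectors which is invariant under the Laplacian and vanishes on the control nodes contains only
  the zero vector.  By duality the system can be steered between any two states, which is done
  explicitly with polynomial inputs.  So the controlling sets are those that contain at least
  \<open>m\<^sub>i - 1\<close> nodes of each cell, and the rest is counting.
\<close>


section \<open>Cotrees\<close>

text \<open>The obstacle is the constant function. At a union node the Laplacian splits over the
  children; at a join node only the Laplacian of the complement does, and the two agree, up to sign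
  and a multiple of the identity, only on functions with sum 0. So the induction treats zero-sum
  functions and either Laplacian, and at the root one application of the Laplacian produces zero
  sums. There, connectedness leaves a single constant, which one control node makes 0. Working with
  sets closed under the Laplacian instead of eigenvectors replaces spectral theory by the quadratic
  form of the Laplacian; steering by polynomials likewise avoids matrix exponentials and the
  controllability Gramian. As \<open>cotree\<close> is a definite description, existence and
  uniqueness have to come before any statement about siblings.\<close>

definition separates :: "'a rel \<Rightarrow> label \<Rightarrow> 'a ltree fset \<Rightarrow> bool" where
  "separates E b ts \<longleftrightarrow>
     (\<forall>s\<in>fset ts. \<forall>t\<in>fset ts. s \<noteq> t \<longrightarrow>
        (\<forall>u\<in>leaves s. \<forall>w\<in>leaves t. (u, w) \<in> E \<longleftrightarrow> b = Label1))"

definition cotree_node :: "'a rel \<Rightarrow> label \<Rightarrow> 'a ltree fset \<Rightarrow> bool" where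
  "cotree_node E b ts \<longleftrightarrow>
     2 \<le> fcard ts \<and> disjoint_family_on leaves (fset ts) \<and>
     (\<forall>c us. Node c us \<in> fset ts \<longrightarrow> c \<noteq> b) \<and> separates E b ts"

text \<open>The condition of \<open>is_cotree\<close> freed from the vertex set: only arcs between
  leaves enter, so it passes to subtrees and to larger graphs with the same arcs on the
  leaves.\<close>

definition represents :: "'a rel \<Rightarrow> 'a ltree \<Rightarrow> bool" where
  "represents E T \<longleftrightarrow> (\<forall>b ts. Node b ts \<in> subtrees T \<longrightarrow> cotree_node E b ts)"

lemma represents_Leaf [simp]: "represents E (Leaf v)"
  by (simp add: represents_def)

lemma represents_Node [simp]:
  "represents E (Node b ts) \<longleftrightarrow> cotree_node E b ts \<and> (\<forall>t\<in>fset ts. represents E t)"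
  by (auto simp: represents_def)

lemma leaves_nonempty: "represents E T \<Longrightarrow> leaves T \<noteq> {}"
proof (induction T)
  case (Node b ts)
  then have "fset ts \<noteq> {}"
    by (auto simp: cotree_node_def fcard.rep_eq)
  with Node show ?case by fastforce
qed simp

lemma finite_leaves: "finite (leaves T)"
  by (induction T) auto

lemma induced_simps [simp]:
  "pverts (induced G S) = S" "parcs (induced G S) = parcs G \<inter> S \<times> S"
  by (simp_all add: induced_def)

lemma graph_union_simps [simp]:
  "pverts (graph_union \<G>) = (\<Union>G\<in>\<G>. pverts G)" "parcs (graph_union \<G>) = (\<Union>G\<in>\<G>. parcs G)"
  by (simp_all add: graph_union_def)

lemma graph_join_simps [simp]:
  "pverts (graph_join \<G>) = (\<Union>G\<in>\<G>. pverts G)"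
  "parcs (graph_join \<G>) =
     (\<Union>G\<in>\<G>. parcs G) \<union> (\<Union>G\<in>\<G>. \<Union>H\<in>\<G> - {G}. pverts G \<times> pverts H)"
  by (simp_all add: graph_join_def)

text \<open>Arcs inside one child agree on both sides automatically, so the equation of graphs only
  constrains arcs between different children: none for a union, all for a join.\<close>

lemma induced_children_iff:
  assumes disj: "disjoint_family_on leaves (fset ts)"
    and ne: "\<And>t. t \<in> fset ts \<Longrightarrow> leaves t \<noteq> {}"
  shows "induced G (leaves (Node b ts)) =
           (case b of Label0 \<Rightarrow> graph_union | Label1 \<Rightarrow> graph_join)
             ((\<lambda>t. induced G (leaves t)) ` fset ts) \<longleftrightarrow> separates (parcs G) b ts"
proof -
  have eq: "s = t" if "s \<in> fset ts" "t \<in> fset ts" "u \<in> leaves s" "u \<in> leaves t" for s t u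
    using disj that unfolding disjoint_family_on_def by blast
  \<comment> \<open>\<open>graph_join\<close> links different graphs, not different children;
    disjoint nonempty leaf sets make this the same.\<close>
  have ind: "induced G (leaves s) = induced G (leaves t) \<longleftrightarrow> s = t"
    if "s \<in> fset ts" "t \<in> fset ts" for s t
    using eq ne that by (metis all_not_in_conv induced_simps(1))
  define X where "X = (\<Union>s\<in>fset ts. \<Union>t\<in>fset ts - {s}. leaves s \<times> leaves t)"
  define \<G> where "\<G> = (\<lambda>t. induced G (leaves t)) ` fset ts"
  define R where "R = (case b of Label0 \<Rightarrow> graph_union | Label1 \<Rightarrow> graph_join) \<G>"
  have S: "leaves (Node b ts) = (\<Union>t\<in>fset ts. leaves t)"
    by auto
  have join: "(\<Union>G'\<in>\<G>. \<Union>H\<in>\<G> - {G'}. pverts G' \<times> pverts H) = X"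
  proof -
    have "\<G> - {induced G (leaves s)} = (\<lambda>t. induced G (leaves t)) ` (fset ts - {s})"
      if "s \<in> fset ts" for s
      using ind that unfolding \<G>_def by blast
    then show ?thesis
      unfolding X_def by (subst (1) \<G>_def) simp
  qed
  have R: "pverts R = leaves (Node b ts)"
    "parcs R = (\<Union>t\<in>fset ts. parcs G \<inter> leaves t \<times> leaves t) \<union> (if b = Label1 then X else {})"
    unfolding R_def S by (cases b; simp add: join; simp add: \<G>_def)+
  have "induced G (leaves (Node b ts)) = R \<longleftrightarrow> parcs (induced G (leaves (Node b ts))) = parcs R"
    using R(1) by (metis induced_simps(1) pair_pre_digraph.equality unit.exhaust)
  also have "\<dots> \<longleftrightarrow> separates (parcs G) b ts"
  proof
    assume eqR: "parcs (induced G (leaves (Node b ts))) = parcs R"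
    show "separates (parcs G) b ts"
      unfolding separates_def
    proof (intro ballI impI)
      fix s t u w assume *: "s \<in> fset ts" "t \<in> fset ts" "s \<noteq> t" "u \<in> leaves s" "w \<in> leaves t"
      then have "(u, w) \<in> leaves (Node b ts) \<times> leaves (Node b ts)" "(u, w) \<in> X"
        unfolding S X_def by blast+
      moreover have "(u, w) \<notin> leaves t' \<times> leaves t'" if "t' \<in> fset ts" for t'
        using eq * that by blast
      moreover have "(u, w) \<in> parcs G \<longleftrightarrow> (u, w) \<in> parcs R"
        using calculation(1) unfolding eqR[symmetric] induced_simps by blast
      ultimately show "((u, w) \<in> parcs G) = (b = Label1)"
        unfolding R(2) by (cases "b = Label1") auto
    qed
  next
    assume sep: "separates (parcs G) b ts"
    have "(u, w) \<in> parcs (induced G (leaves (Node b ts))) \<longleftrightarrow> (u, w) \<in> parcs R" for u w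
    proof (cases "\<exists>s\<in>fset ts. \<exists>t\<in>fset ts. u \<in> leaves s \<and> w \<in> leaves t")
      case True
      then obtain s t where *: "s \<in> fset ts" "t \<in> fset ts" "u \<in> leaves s" "w \<in> leaves t"
        by blast
      have mem: "(u, w) \<in> leaves (Node b ts) \<times> leaves (Node b ts)"
        using * unfolding S by blast
      show ?thesis
      proof (cases "s = t")
        case True
        have "(u, w) \<notin> X"
          unfolding X_def using eq * True by blast
        then show ?thesis
          using mem * True unfolding R(2) by auto
      next
        case False
        then have "(u, w) \<in> X"
          unfolding X_def using * by blast
        moreover have "(u, w) \<notin> leaves t' \<times> leaves t'" if "t' \<in> fset ts" for t'
          using eq * that False by blast
        moreover have "(u, w) \<in> parcs G \<longleftrightarrow> b = Label1"
          using sep * False unfolding separates_def by blast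
        ultimately show ?thesis
          using mem unfolding R(2) by auto
      qed
    next
      case False
      then show ?thesis
        unfolding R(2) X_def induced_simps S by auto
    qed
    then show "parcs (induced G (leaves (Node b ts))) = parcs R"
      by auto
  qed
  finally show ?thesis
    unfolding R_def \<G>_def .
qed

definition raw_node :: "'a pair_pre_digraph \<Rightarrow> label \<Rightarrow> 'a ltree fset \<Rightarrow> bool" where
  "raw_node G b ts \<longleftrightarrow> 2 \<le> fcard ts \<and>
        disjoint_family_on leaves (fset ts) \<and>
        (\<forall>c us. Node c us \<in> fset ts \<longrightarrow> c \<noteq> b) \<and>
        induced G (leaves (Node b ts)) =
          (case b of Label0 \<Rightarrow> graph_union | Label1 \<Rightarrow> graph_join)
            ((\<lambda>t. induced G (leaves t)) ` fset ts)"

text \<open>Induction from the leaves upwards, because the two node conditions are only known to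
  agree once the children have nonempty leaf sets.\<close>

lemma represents_iff:
  "(\<forall>b ts. Node b ts \<in> subtrees T \<longrightarrow> raw_node G b ts) \<longleftrightarrow> represents (parcs G) T"
proof (induction T)
  case (Node b ts)
  have "(\<forall>c us. Node c us \<in> subtrees (Node b ts) \<longrightarrow> raw_node G c us) \<longleftrightarrow>
     raw_node G b ts \<and> (\<forall>t\<in>fset ts. \<forall>b ts. Node b ts \<in> subtrees t \<longrightarrow> raw_node G b ts)"
    by auto
  also have "\<dots> \<longleftrightarrow> raw_node G b ts \<and> (\<forall>t\<in>fset ts. represents (parcs G) t)"
    using Node by blast
  also have "\<dots> \<longleftrightarrow> cotree_node (parcs G) b ts \<and> (\<forall>t\<in>fset ts. represents (parcs G) t)"
    using induced_children_iff[of ts G b] leaves_nonempty unfolding raw_node_def cotree_node_def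
    by meson
  finally show ?case by simp
qed simp

lemma is_cotree_iff: "is_cotree G T \<longleftrightarrow> leaves T = pverts G \<and> represents (parcs G) T"
  unfolding is_cotree_def represents_iff[symmetric] raw_node_def by blast

lemma represents_cong:
  assumes "represents E T" and "\<And>u w. u \<in> leaves T \<Longrightarrow> w \<in> leaves T \<Longrightarrow> (u, w) \<in> E \<longleftrightarrow> (u, w) \<in> E'"
  shows "represents E' T"
  using assms
proof (induction T)
  case (Node b ts)
  have "(u, w) \<in> E \<longleftrightarrow> (u, w) \<in> E'"
    if "s \<in> fset ts" "t \<in> fset ts" "u \<in> leaves s" "w \<in> leaves t" for s t u w
    using that by (intro Node.prems(2)) auto
  moreover have "represents E' t" if "t \<in> fset ts" for t
    using that Node.prems(1) calculation by (intro Node.IH) auto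
  ultimately show ?case
    using Node.prems(1) unfolding represents_Node cotree_node_def separates_def by meson
qed simp

section \<open>Existence of cotrees\<close>

lemma cograph_parcs: "cograph G \<Longrightarrow> parcs G \<subseteq> pverts G \<times> pverts G"
  by (induction rule: cograph.induct) auto

text \<open>What a tree contributes to a new root labelled \<open>b\<close>: a root that already has
  this label is dissolved, so that labels keep alternating.\<close>

primrec parts :: "label \<Rightarrow> 'a ltree \<Rightarrow> 'a ltree fset" where
  "parts b (Leaf v) = {|Leaf v|}"
| "parts b (Node c ts) = (if c = b then ts else {|Node c ts|})"

lemma parts:
  assumes "represents E T"
  shows "(\<Union>t\<in>fset (parts b T). leaves t) = leaves T"
    and "\<forall>t\<in>fset (parts b T). represents E t"
    and "disjoint_family_on leaves (fset (parts b T))"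
    and "\<forall>c us. Node c us \<in> fset (parts b T) \<longrightarrow> c \<noteq> b"
    and "separates E b (parts b T)"
  using assms by (cases T; auto simp: cotree_node_def separates_def disjoint_family_on_def)+

lemma represents_merge:
  assumes T: "represents E T" and U: "represents E U" and disj: "leaves T \<inter> leaves U = {}"
    and sep: "\<And>u w. u \<in> leaves T \<Longrightarrow> w \<in> leaves U \<Longrightarrow> (u, w) \<in> E \<longleftrightarrow> b = Label1"
      "\<And>u w. u \<in> leaves T \<Longrightarrow> w \<in> leaves U \<Longrightarrow> (w, u) \<in> E \<longleftrightarrow> b = Label1"
  shows "\<exists>V. leaves V = leaves T \<union> leaves U \<and> represents E V"
proof (intro exI conjI)
  let ?ts = "parts b T |\<union>| parts b U"
  have subT: "u \<in> leaves T" if "t \<in> fset (parts b T)" "u \<in> leaves t" for t u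
    using parts(1)[OF T, of b] that by blast
  have subU: "u \<in> leaves U" if "t \<in> fset (parts b U)" "u \<in> leaves t" for t u
    using parts(1)[OF U, of b] that by blast
  have rep: "\<forall>t\<in>fset ?ts. represents E t"
    using parts(2) T U by auto
  show "leaves (Node b ?ts) = leaves T \<union> leaves U"
    using parts(1)[OF T, of b] parts(1)[OF U, of b] by auto
  \<comment> \<open>Children form a set and might coincide; a part of \<open>T\<close> and a part of
    \<open>U\<close> differ because their leaves do.\<close>
  have "2 \<le> fcard ?ts"
  proof -
    obtain u w where "u \<in> leaves T" "w \<in> leaves U"
      using leaves_nonempty T U by blast
    then obtain s t where st: "s \<in> fset (parts b T)" "t \<in> fset (parts b U)"
      "u \<in> leaves s" "w \<in> leaves t"
      using parts(1)[OF T, of b] parts(1)[OF U, of b] by blast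
    then have "s \<noteq> t"
      using subT subU disj by blast
    moreover have "{s, t} \<subseteq> fset ?ts"
      using st by auto
    then have "card {s, t} \<le> fcard ?ts"
      unfolding fcard.rep_eq by (intro card_mono) auto
    ultimately show ?thesis
      by simp
  qed
  moreover have "disjoint_family_on leaves (fset (parts b T) \<union> fset (parts b U))"
    using parts(3)[OF T, of b] parts(3)[OF U, of b] subT subU disj
    unfolding disjoint_family_on_def by blast
  then have "disjoint_family_on leaves (fset ?ts)"
    by simp
  moreover have "\<forall>c us. Node c us \<in> fset ?ts \<longrightarrow> c \<noteq> b"
    using parts(4)[OF T, of b] parts(4)[OF U, of b] by auto
  moreover have "separates E b ?ts"
    unfolding separates_def
  proof (intro ballI impI)
    fix s t u w assume *: "s \<in> fset ?ts" "t \<in> fset ?ts" "s \<noteq> t" "u \<in> leaves s" "w \<in> leaves t"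
    consider "s \<in> fset (parts b T)" "t \<in> fset (parts b T)" | "s \<in> fset (parts b U)" "t \<in> fset (parts b U)"
      | "s \<in> fset (parts b T)" "t \<in> fset (parts b U)" | "s \<in> fset (parts b U)" "t \<in> fset (parts b T)"
      using *(1,2) by auto
    then show "(u, w) \<in> E \<longleftrightarrow> b = Label1"
    proof cases
      case 1
      then show ?thesis using parts(5)[OF T, of b] * unfolding separates_def by blast
    next
      case 2
      then show ?thesis using parts(5)[OF U, of b] * unfolding separates_def by blast
    next
      case 3
      then show ?thesis using sep(1) subT subU * by blast
    next
      case 4
      then show ?thesis using sep(2) subT subU * by blast
    qed
  qed
  ultimately show "represents E (Node b ?ts)"
    using rep by (simp add: cotree_node_def)
qed

lemma represents_merge_cographs:
  assumes T: "is_cotree G T" "parcs G \<subseteq> pverts G \<times> pverts G"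
    and U: "is_cotree H U" "parcs H \<subseteq> pverts H \<times> pverts H"
    and disj: "pverts G \<inter> pverts H = {}"
  shows "\<exists>V. is_cotree ((case b of Label0 \<Rightarrow> graph_union | Label1 \<Rightarrow> graph_join) {G, H}) V"
proof -
  let ?K = "(case b of Label0 \<Rightarrow> graph_union | Label1 \<Rightarrow> graph_join) {G, H}"
  have ne: "pverts G \<noteq> {}" "pverts H \<noteq> {}"
    using T(1) U(1) leaves_nonempty is_cotree_iff by metis+
  \<comment> \<open>For equal graphs \<open>{G, H}\<close> would be a singleton and the join would
    add no arcs.\<close>
  then have "G \<noteq> H"
    using disj by auto
  then have K: "pverts ?K = pverts G \<union> pverts H"
    "parcs ?K = parcs G \<union> parcs H \<union>
      (if b = Label1 then pverts G \<times> pverts H \<union> pverts H \<times> pverts G else {})"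
    by (cases b; auto)+
  have "represents (parcs ?K) T"
    using T(1) unfolding is_cotree_iff
    by (elim conjE represents_cong) (use disj T(2) U(2) in \<open>auto simp: K(2) split: if_splits\<close>)
  moreover have "represents (parcs ?K) U"
    using U(1) unfolding is_cotree_iff
    by (elim conjE represents_cong) (use disj T(2) U(2) in \<open>auto simp: K(2) split: if_splits\<close>)
  moreover have "leaves T \<inter> leaves U = {}"
    using T(1) U(1) disj by (simp add: is_cotree_iff)
  moreover have "(u, w) \<in> parcs ?K \<longleftrightarrow> b = Label1" "(w, u) \<in> parcs ?K \<longleftrightarrow> b = Label1"
    if "u \<in> leaves T" "w \<in> leaves U" for u w
    using that T U disj by (auto simp: K(2) is_cotree_iff)
  ultimately obtain V where "leaves V = leaves T \<union> leaves U" "represents (parcs ?K) V"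
    using represents_merge[of "parcs ?K" T U b] by blast
  then show ?thesis
    using T(1) U(1) K(1) unfolding is_cotree_iff by metis
qed

lemma cotree_exists:
  assumes "cograph G"
  shows "\<exists>T. is_cotree G T"
  using assms
proof induction
  case (node v)
  have "is_cotree \<lparr>pverts = {v}, parcs = {}\<rparr> (Leaf v)"
    by (simp add: is_cotree_iff)
  then show ?case by blast
next
  case (union G H)
  then show ?case
    using represents_merge_cographs[of G _ H _ Label0] cograph_parcs by fastforce
next
  case (join G H)
  then show ?case
    using represents_merge_cographs[of G _ H _ Label1] cograph_parcs by fastforce
qed

section \<open>Uniqueness of cotrees and their children\<close>

lemma
  shows leaf_in_leaves: "Leaf v \<in> fset ts \<Longrightarrow> v \<in> leaves (Node b ts)"
    and child_in_leaves: "t \<in> fset ts \<Longrightarrow> u \<in> leaves t \<Longrightarrow> u \<in> leaves (Node b ts)"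
  by force+

lemma child_eq:
  assumes "cotree_node E b ts" "s \<in> fset ts" "t \<in> fset ts" "u \<in> leaves s" "u \<in> leaves t"
  shows "s = t"
  using assms unfolding cotree_node_def disjoint_family_on_def by blast

lemma arc_iff:
  assumes "cotree_node E b ts" "s \<in> fset ts" "t \<in> fset ts" "s \<noteq> t" "u \<in> leaves s" "w \<in> leaves t"
  shows "(u, w) \<in> E \<longleftrightarrow> b = Label1"
  using assms unfolding cotree_node_def separates_def by blast

lemma other_child:
  assumes "cotree_node E b ts" "s \<in> fset ts"
  obtains t where "t \<in> fset ts" "t \<noteq> s"
proof -
  have "\<not> fset ts \<subseteq> {s}"
  proof
    assume "fset ts \<subseteq> {s}"
    then have "card (fset ts) \<le> card {s}"
      by (intro card_mono) auto
    then show False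
      using assms(1) by (simp add: cotree_node_def fcard.rep_eq)
  qed
  then show ?thesis
    using that by blast
qed

text \<open>
  Join nodes have connected graphs, and union nodes have graphs with connected complements.
\<close>

lemma node_connected:
  assumes T: "represents E (Node c ts)"
    and closed: "\<And>u w. u \<in> leaves (Node c ts) \<Longrightarrow> w \<in> leaves (Node c ts) \<Longrightarrow> u \<noteq> w \<Longrightarrow>
      ((u, w) \<in> E \<longleftrightarrow> c = Label1) \<Longrightarrow> f u = f w"
    and uw: "u \<in> leaves (Node c ts)" "w \<in> leaves (Node c ts)"
  shows "f u = f w"
proof -
  have node: "cotree_node E c ts"
    using T by simp
  have step: "f x = f y"
    if "s \<in> fset ts" "t \<in> fset ts" "s \<noteq> t" "x \<in> leaves s" "y \<in> leaves t" for s t x y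
  proof (rule closed)
    show "x \<noteq> y"
      using child_eq[OF node] that by blast
    show "((x, y) \<in> E) = (c = Label1)"
      using arc_iff[OF node] that by blast
  qed (use that in auto)
  obtain s t where st: "s \<in> fset ts" "t \<in> fset ts" "u \<in> leaves s" "w \<in> leaves t"
    using uw by auto
  show ?thesis
  proof (cases "s = t")
    case True
    \<comment> \<open>Two leaves of the same child are linked through a leaf of another
      child.\<close>
    obtain r where r: "r \<in> fset ts" "r \<noteq> s"
      using other_child[OF node st(1)] by blast
    then obtain x where "x \<in> leaves r"
      using T leaves_nonempty by fastforce
    then show ?thesis
      using step[of s r u x] step[of t r w x] st r True by metis
  qed (use st step in blast)
qed

text \<open>If the labels differed, the pairs related according to \<open>b\<close> would never
  cross between children of \<open>Node c us\<close>. The map from a leaf to its child in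
  \<open>us\<close> would then be constant by \<open>node_connected\<close>, although there are two
  children.\<close>

lemma root_label_unique:
  assumes T: "represents E (Node b ts)" and U: "represents E (Node c us)"
    and L: "leaves (Node b ts) = leaves (Node c us)"
  shows "b = c"
proof (rule ccontr)
  assume bc: "b \<noteq> c"
  have node: "cotree_node E c us"
    using U by simp
  define f where "f u = (THE t. t \<in> fset us \<and> u \<in> leaves t)" for u
  have f: "f u = t" if "t \<in> fset us" "u \<in> leaves t" for u t
    unfolding f_def using that child_eq[OF node] by (intro the_equality) blast+
  have const: "f u = f w" if "u \<in> leaves (Node b ts)" "w \<in> leaves (Node b ts)" for u w
    using T _ that
  proof (rule node_connected)
    fix x y assume *: "x \<in> leaves (Node b ts)" "y \<in> leaves (Node b ts)"
      "((x, y) \<in> E) = (b = Label1)"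
    then obtain s t where st: "s \<in> fset us" "t \<in> fset us" "x \<in> leaves s" "y \<in> leaves t"
      unfolding L by auto
    then have "s = t"
      using arc_iff[OF node st(1,2) _ st(3,4)] * bc by (metis label.exhaust)
    then show "f x = f y"
      using f st by metis
  qed
  have "us \<noteq> {||}"
    using node by (auto simp: cotree_node_def fcard.rep_eq)
  then obtain s where s: "s \<in> fset us"
    by auto
  then obtain t where t: "t \<in> fset us" "t \<noteq> s"
    using other_child[OF node] by blast
  obtain u w where uw: "u \<in> leaves s" "w \<in> leaves t"
    using U s t leaves_nonempty by fastforce
  then have "u \<in> leaves (Node c us)" "w \<in> leaves (Node c us)"
    using s t by auto
  then show False
    using const[of u w] f uw s t unfolding L by metis
qed

text \<open>The argument of \<open>root_label_unique\<close>, applied to one child: an inner child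
  carries the label opposite to \<open>b\<close>, so it is connected by pairs that cannot leave a
  child of the other root.\<close>

lemma child_subset:
  assumes T: "represents E (Node b ts)" and U: "represents E (Node b us)"
    and L: "leaves (Node b ts) = leaves (Node b us)" and s: "s \<in> fset ts"
  shows "\<exists>t\<in>fset us. leaves s \<subseteq> leaves t"
proof (cases s)
  case (Leaf v)
  then have "v \<in> leaves (Node b ts)"
    using s leaf_in_leaves by metis
  then have "v \<in> leaves (Node b us)"
    unfolding L .
  then show ?thesis
    using Leaf by simp
next
  case (Node c vs)
  have node: "cotree_node E b us"
    using U by simp
  have "\<forall>t\<in>fset ts. represents E t" "\<forall>c us. Node c us \<in> fset ts \<longrightarrow> c \<noteq> b"
    using T by (simp_all add: cotree_node_def)
  then have Tc: "represents E (Node c vs)" and bc: "c \<noteq> b"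
    using s unfolding Node by blast+
  have sub: "leaves s \<subseteq> leaves (Node b us)"
    unfolding L[symmetric] using s by auto
  define f where "f u = (THE t. t \<in> fset us \<and> u \<in> leaves t)" for u
  have f: "f u = t" if "t \<in> fset us" "u \<in> leaves t" for u t
    unfolding f_def using that child_eq[OF node] by (intro the_equality) blast+
  have const: "f u = f w" if "u \<in> leaves (Node c vs)" "w \<in> leaves (Node c vs)" for u w
    using Tc _ that
  proof (rule node_connected)
    fix x y assume *: "x \<in> leaves (Node c vs)" "y \<in> leaves (Node c vs)"
      "((x, y) \<in> E) = (c = Label1)"
    then obtain s t where st: "s \<in> fset us" "t \<in> fset us" "x \<in> leaves s" "y \<in> leaves t"
      using sub unfolding Node by (metis UN_iff ltree.set(2) subsetD)
    then have "s = t"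
      using arc_iff[OF node st(1,2) _ st(3,4)] * bc by (metis label.exhaust)
    then show "f x = f y"
      using f st by metis
  qed
  obtain u where u: "u \<in> leaves s"
    using Tc Node leaves_nonempty by blast
  then obtain t where t: "t \<in> fset us" "u \<in> leaves t"
    using sub by (metis UN_iff ltree.set(2) subsetD)
  have "w \<in> leaves t" if "w \<in> leaves s" for w
  proof -
    have "w \<in> leaves (Node b us)"
      using sub that by blast
    then obtain r where r: "r \<in> fset us" "w \<in> leaves r"
      by auto
    then show ?thesis
      using const[of u w] f[OF t] f[OF r] that u Node by simp
  qed
  then show ?thesis
    using t by blast
qed

text \<open>Going to the other tree and back encloses \<open>s\<close> in some child
  \<open>r\<close> of its own tree; sharing a leaf, \<open>s\<close> and \<open>r\<close> coincide,
  and the inclusions are equalities.\<close>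

lemma child_leaves_eq:
  assumes T: "represents E (Node b ts)" and U: "represents E (Node b us)"
    and L: "leaves (Node b ts) = leaves (Node b us)" and s: "s \<in> fset ts"
  shows "\<exists>t\<in>fset us. leaves s = leaves t"
proof -
  obtain t where t: "t \<in> fset us" "leaves s \<subseteq> leaves t"
    using child_subset[OF T U L s] by blast
  obtain r where r: "r \<in> fset ts" "leaves t \<subseteq> leaves r"
    using child_subset[OF U T L[symmetric] t(1)] by blast
  obtain u where "u \<in> leaves s"
    using T s leaves_nonempty by fastforce
  then have "s = r"
    using child_eq[of E b ts s r u] T s r t by auto
  then show ?thesis
    using t r by blast
qed

lemma represents_unique:
  assumes "represents E T" "represents E U" "leaves T = leaves U"
  shows "T = U"
proof -
  \<comment> \<open>An inner node has two children with disjoint nonempty leaf sets, hence more than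
    one leaf.\<close>
  have leaf: False if "represents E (Node c us)" "{v} = leaves (Node c us)" for v c us
  proof -
    have node: "cotree_node E c us"
      using that by simp
    have "v \<in> leaves (Node c us)"
      unfolding that(2)[symmetric] by blast
    then obtain s where s: "s \<in> fset us" "v \<in> leaves s"
      by auto
    obtain t where t: "t \<in> fset us" "t \<noteq> s"
      using other_child[OF node s(1)] by blast
    have "represents E t"
      using that(1) t(1) by simp
    then obtain w where "w \<in> leaves t"
      using leaves_nonempty by blast
    moreover have "w \<in> {v}"
      unfolding that(2) using t(1) calculation by (rule child_in_leaves)
    ultimately show False
      using child_eq[OF node s(1) t(1) s(2)] t by auto
  qed
  show ?thesis
    using assms
  proof (induction T arbitrary: U)
    case (Leaf v)
    then show ?case
      using leaf[of _ _ v] by (cases U) auto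
  next
    case (Node b ts)
    show ?case
    proof (cases U)
      case (Leaf v)
      then show ?thesis
        using leaf[of b ts v] Node.prems by simp
    next
      case U: (Node c us)
      have bc: "c = b"
        using root_label_unique[of E b ts c us] Node.prems U by simp
      have L: "leaves (Node b ts) = leaves (Node b us)"
        using Node.prems U bc by simp
      have TU: "represents E (Node b ts)" "represents E (Node b us)"
        using Node.prems(1,2) U bc by simp_all
      have eq: "s = t" if "s \<in> fset ts" "t \<in> fset us" "leaves s = leaves t" for s t
        using Node.IH[of s t] TU that by simp
      have "s \<in> fset us" if "s \<in> fset ts" for s
        using child_leaves_eq[OF TU L that] eq that by blast
      moreover have "s \<in> fset ts" if "s \<in> fset us" for s
        using child_leaves_eq[OF TU(2,1) L[symmetric] that] eq that by metis
      ultimately have "ts = us"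
        by (auto simp: fset_eq_iff)
      then show ?thesis
        using U bc by simp
    qed
  qed
qed

lemma cotree_is_cotree: "cograph G \<Longrightarrow> is_cotree G (cotree G)"
  unfolding cotree_def
proof (rule theI')
  assume "cograph G"
  then show "\<exists>!T. is_cotree G T"
    using cotree_exists represents_unique unfolding is_cotree_iff by metis
qed

section \<open>Siblings and twins\<close>

lemma subtrees_represents:
  assumes "t \<in> subtrees T" "represents E T"
  shows "represents E t \<and> leaves t \<subseteq> leaves T"
  using assms
proof (induction T)
  case (Node b ts)
  show ?case
  proof (cases "t = Node b ts")
    case False
    then obtain x where "x \<in> fset ts" "t \<in> subtrees x"
      using Node.prems(1) by auto
    then show ?thesis
      using Node.IH[of x] Node.prems(2) child_in_leaves[of x ts _ b] by auto
  qed (use Node.prems in simp)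
qed simp

text \<open>Makes \<open>siblings\<close> transitive. Below the root, both nodes lie in the one
  child containing \<open>v\<close>; if just one of them were the root, that child would be
  \<open>Leaf v\<close>, which has no inner nodes.\<close>

lemma parent_unique:
  assumes "represents E T" "Node b ts \<in> subtrees T" "Node c us \<in> subtrees T"
    and "Leaf v \<in> fset ts" "Leaf v \<in> fset us"
  shows "Node b ts = Node c us"
  using assms
proof (induction T)
  case (Node a xs)
  have node: "cotree_node E a xs"
    using Node.prems by simp
  have sub: "\<exists>x\<in>fset xs. Node c' us' \<in> subtrees x \<and> v \<in> leaves x \<and> x \<noteq> Leaf v"
    if "Node c' us' \<in> subtrees (Node a xs)" "Leaf v \<in> fset us'" "Node c' us' \<noteq> Node a xs" for c' us'
  proof -
    have "Node c' us' \<in> (\<Union>x\<in>fset xs. subtrees x)"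
      using that(1,3) by auto
    then obtain x where x: "x \<in> fset xs" "Node c' us' \<in> subtrees x"
      by blast
    then have "leaves (Node c' us') \<subseteq> leaves x"
      using subtrees_represents[of "Node c' us'" x E] Node.prems(1) by simp
    moreover have "v \<in> leaves (Node c' us')"
      using that(2) by (rule leaf_in_leaves)
    ultimately have "v \<in> leaves x"
      by blast
    moreover have "x \<noteq> Leaf v"
      using x(2) by auto
    ultimately show ?thesis
      using x by blast
  qed
  show ?case
  proof (cases "Node b ts = Node a xs \<or> Node c us = Node a xs")
    case True
    have only: "x = Leaf v" if "Leaf v \<in> fset xs" "x \<in> fset xs" "v \<in> leaves x" for x
      using child_eq[OF node that(1,2) _ that(3)] by simp
    have "Node c us = Node a xs" if "Node b ts = Node a xs"
    proof -
      have "Leaf v \<in> fset xs"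
        using that Node.prems(4) by simp
      then show ?thesis
        using sub[OF Node.prems(3,5)] only by metis
    qed
    moreover have "Node b ts = Node a xs" if "Node c us = Node a xs"
    proof -
      have "Leaf v \<in> fset xs"
        using that Node.prems(5) by simp
      then show ?thesis
        using sub[OF Node.prems(2,4)] only by metis
    qed
    ultimately show ?thesis
      using True by metis
  next
    case False
    obtain x where x: "x \<in> fset xs" "Node b ts \<in> subtrees x" "v \<in> leaves x"
      using sub[OF Node.prems(2,4)] False by blast
    obtain y where y: "y \<in> fset xs" "Node c us \<in> subtrees y" "v \<in> leaves y"
      using sub[OF Node.prems(3,5)] False by blast
    have "x = y"
      using child_eq[OF node x(1) y(1) x(3) y(3)] .
    then show ?thesis
      using Node.IH[OF x(1) _ x(2)] Node.prems(1,4,5) x(1) y(2) by simp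
  qed
qed simp

text \<open>An arc is decided by the label of the lowest node above both ends, and towards a third
  leaf \<open>w\<close> this node is the same for \<open>u\<close> and \<open>v\<close>.\<close>

lemma siblings_twins:
  assumes "represents E T" "Node b ts \<in> subtrees T" "Leaf u \<in> fset ts" "Leaf v \<in> fset ts"
    and "w \<in> leaves T" "w \<noteq> u" "w \<noteq> v"
  shows "(u, w) \<in> E \<longleftrightarrow> (v, w) \<in> E"
  using assms
proof (induction T)
  case (Node a xs)
  have node: "cotree_node E a xs"
    using Node.prems by simp
  obtain y where y: "y \<in> fset xs" "w \<in> leaves y"
    using Node.prems by auto
  show ?case
  proof (cases "Node b ts = Node a xs")
    case True
    moreover have "y \<noteq> Leaf u" "y \<noteq> Leaf v"
      using y Node.prems by auto
    ultimately show ?thesis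
      using arc_iff[OF node _ y(1) _ _ y(2), of "Leaf u" u] arc_iff[OF node _ y(1) _ _ y(2), of "Leaf v" v]
        Node.prems(3,4) by auto
  next
    case False
    then obtain x where x: "x \<in> fset xs" "Node b ts \<in> subtrees x"
      using Node.prems by auto
    have "leaves (Node b ts) \<subseteq> leaves x"
      using subtrees_represents[OF x(2), of E] x(1) Node.prems(1) by simp
    then have uv: "u \<in> leaves x" "v \<in> leaves x"
      using leaf_in_leaves[OF Node.prems(3), of b] leaf_in_leaves[OF Node.prems(4), of b] by auto
    show ?thesis
    proof (cases "x = y")
      case True
      then show ?thesis
        using Node.IH[OF x(1)] x y Node.prems by simp
    next
      case False
      then show ?thesis
        using arc_iff[OF node x(1) y(1)] uv y by simp
    qed
  qed
qed simp


section \<open>Steering by polynomial inputs\<close>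

lemma higher_pderiv_add_smult:
  fixes p q :: "real poly"
  shows "(pderiv ^^ k) (p + smult c q) = (pderiv ^^ k) p + smult c ((pderiv ^^ k) q)"
  by (induction k) (simp_all add: pderiv_add pderiv_smult)

text \<open>The constant \<open>c\<close> is e (e - 1) ... (e - k + 1); all that matters later is
  that it is not 0.\<close>

lemma higher_pderiv_root_power:
  fixes a :: real
  assumes "k \<le> e"
  shows "\<exists>r c. (pderiv ^^ k) ([:- a, 1:] ^ e * q) = [:- a, 1:] ^ (e - k) * r \<and>
    c \<noteq> 0 \<and> poly r a = c * poly q a"
  using assms
proof (induction k)
  case 0
  show ?case by (intro exI[of _ q] exI[of _ 1]) simp
next
  case (Suc k)
  then obtain r c where r: "(pderiv ^^ k) ([:- a, 1:] ^ e * q) = [:- a, 1:] ^ (e - k) * r"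
    "c \<noteq> 0" "poly r a = c * poly q a"
    by auto
  obtain m where m: "e - k = Suc m" "e - Suc k = m"
    using Suc.prems by (metis Suc_diff_Suc Suc_le_lessD)
  have "(pderiv ^^ Suc k) ([:- a, 1:] ^ e * q) = pderiv ([:- a, 1:] ^ Suc m * r)"
    using r m by simp
  also have "\<dots> = [:- a, 1:] ^ m * (smult (real (Suc m)) r + [:- a, 1:] * pderiv r)"
    by (simp add: pderiv_mult pderiv_power_Suc pderiv_pCons algebra_simps del: power_Suc)
      (simp add: algebra_simps)
  finally have "(pderiv ^^ Suc k) ([:- a, 1:] ^ e * q) =
      [:- a, 1:] ^ (e - Suc k) * (smult (real (Suc m)) r + [:- a, 1:] * pderiv r)"
    using m by simp
  moreover have "poly (smult (real (Suc m)) r + [:- a, 1:] * pderiv r) a = (real (Suc m) * c) * poly q a"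
    using r(3) by simp
  ultimately show ?case
    using r(2) by (metis mult_eq_0_iff of_nat_eq_0_iff nat.distinct(1))
qed

lemma higher_pderiv_root_power_eval:
  fixes a :: real
  shows "k < e \<Longrightarrow> poly ((pderiv ^^ k) ([:- a, 1:] ^ e * q)) a = 0"
    and "poly q a \<noteq> 0 \<Longrightarrow> poly ((pderiv ^^ e) ([:- a, 1:] ^ e * q)) a \<noteq> 0"
  using higher_pderiv_root_power[of k e a q] higher_pderiv_root_power[of e e a q] by auto

text \<open>Newton's scheme: each further value is corrected by a multiple of a polynomial that does
  not disturb the derivatives already prescribed.\<close>

lemma hermite_interpolation:
  fixes \<alpha> \<beta> :: "nat \<Rightarrow> real"
  shows "\<exists>p :: real poly. (\<forall>k<d. poly ((pderiv ^^ k) p) 0 = \<alpha> k) \<and> (\<forall>k<e. poly ((pderiv ^^ k) p) 1 = \<beta> k)"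
proof (induction e)
  case 0
  show ?case
  proof (induction d)
    case (Suc d)
    then obtain p where p: "\<And>k. k < d \<Longrightarrow> poly ((pderiv ^^ k) p) 0 = \<alpha> k"
      by auto
    \<comment> \<open>The monomial \<open>X ^ d\<close>, written to match the root-power lemma with
      root 0 and cofactor 1.\<close>
    define z where "z = ([:- 0, 1:] :: real poly) ^ d * 1"
    have z: "\<And>k. k < d \<Longrightarrow> poly ((pderiv ^^ k) z) 0 = 0" "poly ((pderiv ^^ d) z) 0 \<noteq> 0"
      unfolding z_def by (rule higher_pderiv_root_power_eval; simp)+
    let ?c = "(\<alpha> d - poly ((pderiv ^^ d) p) 0) / poly ((pderiv ^^ d) z) 0"
    have "poly ((pderiv ^^ k) (p + smult ?c z)) 0 = \<alpha> k" if "k < Suc d" for k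
      using that p z unfolding higher_pderiv_add_smult by (cases "k = d") auto
    then show ?case by blast
  qed auto
next
  case (Suc e)
  then obtain p where p: "\<And>k. k < d \<Longrightarrow> poly ((pderiv ^^ k) p) 0 = \<alpha> k"
    "\<And>k. k < e \<Longrightarrow> poly ((pderiv ^^ k) p) 1 = \<beta> k"
    by auto
  \<comment> \<open>\<open>(X - 1) ^ e * X ^ d\<close> vanishes to order \<open>d\<close> at 0 and
    to order exactly \<open>e\<close> at 1.\<close>
  define z where "z = ([:- 1, 1:] :: real poly) ^ e * [:- 0, 1:] ^ d"
  have z1: "\<And>k. k < e \<Longrightarrow> poly ((pderiv ^^ k) z) 1 = 0" "poly ((pderiv ^^ e) z) 1 \<noteq> 0"
    unfolding z_def by (rule higher_pderiv_root_power_eval; simp)+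
  have "z = [:- 0, 1:] ^ d * [:- 1, 1:] ^ e"
    unfolding z_def by simp
  then have z0: "poly ((pderiv ^^ k) z) 0 = 0" if "k < d" for k
    using higher_pderiv_root_power_eval(1)[OF that, of 0 "[:- 1, 1:] ^ e"] by simp
  let ?c = "(\<beta> e - poly ((pderiv ^^ e) p) 1) / poly ((pderiv ^^ e) z) 1"
  have "poly ((pderiv ^^ k) (p + smult ?c z)) 1 = \<beta> k" if "k < Suc e" for k
    using that p(2) z1 unfolding higher_pderiv_add_smult by (cases "k = e") auto
  moreover have "poly ((pderiv ^^ k) (p + smult ?c z)) 0 = \<alpha> k" if "k < d" for k
    using that p(1) z0 unfolding higher_pderiv_add_smult by simp
  ultimately show ?case by blast
qed

section \<open>Dependent and spanning families of vectors\<close>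

lemma linear_dependence:
  fixes v :: "nat \<Rightarrow> nat \<Rightarrow> real"
  shows "\<exists>p. (\<exists>k\<le>n. p k \<noteq> 0) \<and> (\<forall>i<n. (\<Sum>k\<le>n. p k * v k i) = 0)"
proof -
  \<comment> \<open>The n + 1 vectors are the columns; a zero row makes the matrix square and
    singular.\<close>
  define M where "M = mat\<^sub>r (Suc n) (Suc n)
    (\<lambda>i. if i = n then 0\<^sub>v (Suc n) else vec (Suc n) (\<lambda>k. v k i))"
  have M: "M \<in> carrier_mat (Suc n) (Suc n)"
    by (simp add: M_def)
  have "det M = 0"
    unfolding M_def by (rule det_row_0) auto
  then obtain p where p: "p \<in> carrier_vec (Suc n)" "p \<noteq> 0\<^sub>v (Suc n)" "M *\<^sub>v p = 0\<^sub>v (Suc n)"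
    using det_0_iff_vec_prod_zero[OF M] by blast
  have "\<exists>k\<le>n. p $ k \<noteq> 0"
  proof (rule ccontr)
    assume "\<not> ?thesis"
    then have "p = 0\<^sub>v (Suc n)"
      using p(1) by (intro eq_vecI) auto
    then show False using p(2) by simp
  qed
  moreover have "(\<Sum>k\<le>n. p $ k * v k i) = 0" if "i < n" for i
  proof -
    have "0 = (M *\<^sub>v p) $ i"
      using p(3) that by simp
    also have "\<dots> = (\<Sum>k\<in>{0..<Suc n}. v k i * p $ k)"
      using that p(1) M by (simp add: scalar_prod_def M_def row_def)
    finally show ?thesis
      by (simp add: mult.commute atLeast0LessThan lessThan_Suc_atMost)
  qed
  ultimately show ?thesis
    by (intro exI[of _ "\<lambda>k. p $ k"]) auto
qed

text \<open>The matrix \<open>M\<close>, the sum of the products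
  \<open>v k * transpose (v k)\<close>, has as quadratic form the sum of the squared inner products
  with the \<open>v k\<close>. So its kernel is orthogonal to all of them, \<open>M\<close> is
  invertible, and solving M y = x yields the inner products with y as coefficients.\<close>

lemma spanning_if_no_normal:
  fixes v :: "'i \<Rightarrow> nat \<Rightarrow> real"
  assumes fin: "finite I"
    and normal: "\<And>\<eta>. (\<And>k. k \<in> I \<Longrightarrow> (\<Sum>i<n. v k i * \<eta> i) = 0) \<Longrightarrow> \<forall>i<n. \<eta> i = 0"
  shows "\<exists>c. \<forall>i<n. x i = (\<Sum>k\<in>I. v k i * c k)"
proof -
  define M where "M = mat n n (\<lambda>(i, j). \<Sum>k\<in>I. v k i * v k j)"
  have M: "M \<in> carrier_mat n n"
    by (simp add: M_def)
  have Mv: "(M *\<^sub>v y) $ i = (\<Sum>k\<in>I. v k i * (\<Sum>j<n. v k j * y $ j))"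
    if "y \<in> carrier_vec n" "i < n" for y i
  proof -
    have "(M *\<^sub>v y) $ i = (\<Sum>j<n. (\<Sum>k\<in>I. v k i * v k j) * y $ j)"
      using that by (simp add: M_def scalar_prod_def row_def atLeast0LessThan)
    also have "\<dots> = (\<Sum>k\<in>I. v k i * (\<Sum>j<n. v k j * y $ j))"
      unfolding sum_distrib_left sum_distrib_right
      by (subst sum.swap) (simp add: mult.assoc)
    finally show ?thesis .
  qed
  have "y = 0\<^sub>v n" if y: "y \<in> carrier_vec n" "M *\<^sub>v y = 0\<^sub>v n" for y
  proof -
    have "0 = (\<Sum>i<n. y $ i * (M *\<^sub>v y) $ i)"
      using y by simp
    also have "\<dots> = (\<Sum>i<n. \<Sum>k\<in>I. y $ i * v k i * (\<Sum>j<n. v k j * y $ j))"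
      using Mv[OF y(1)] by (simp add: sum_distrib_left mult.assoc)
    also have "\<dots> = (\<Sum>k\<in>I. (\<Sum>j<n. v k j * y $ j)\<^sup>2)"
      unfolding power2_eq_square by (subst sum.swap) (simp add: sum_distrib_right mult.commute)
    finally have "(\<Sum>j<n. v k j * y $ j) = 0" if "k \<in> I" for k
      using fin that by (simp add: sum_nonneg_eq_0_iff)
    then have "\<forall>i<n. y $ i = 0"
      using normal[of "\<lambda>i. y $ i"] by blast
    then show ?thesis
      using y(1) by (intro eq_vecI) auto
  qed
  then have "det M \<noteq> 0"
    using det_0_iff_vec_prod_zero[OF M] by blast
  then have "M \<in> Units (ring_mat TYPE(real) n ())"
    by (rule det_non_zero_imp_unit[OF M])
  then obtain N where N: "N \<in> carrier_mat n n" "M * N = 1\<^sub>m n"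
    unfolding Units_def ring_mat_def by auto
  define y where "y = N *\<^sub>v vec n x"
  have y: "y \<in> carrier_vec n" "M *\<^sub>v y = vec n x"
    using N M unfolding y_def by (auto simp flip: assoc_mult_mat_vec)
  have "x i = (\<Sum>k\<in>I. v k i * (\<Sum>j<n. v k j * y $ j))" if "i < n" for i
    using Mv[OF y(1) that] y(2) that by simp
  then show ?thesis
    by (intro exI[of _ "\<lambda>k. \<Sum>j<n. v k j * y $ j"]) simp
qed

text \<open>
  The \<open>h k\<close> are the intermediate vectors of the Horner scheme for \<open>(A\<^sup>d + q\<^sub>1 A\<^sup>d\<^sup>-\<^sup>1 + \<dots> + q\<^sub>d) b = 0\<close>.
\<close>

lemma horner_sequence:
  fixes A :: "nat \<Rightarrow> nat \<Rightarrow> real"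
  assumes b: "\<exists>i<n. b i \<noteq> 0"
  shows "\<exists>d h q. 0 < d \<and> h 0 = b \<and> q 0 = 1 \<and> (\<forall>i<n. h d i = 0) \<and>
    (\<forall>k i. h (Suc k) i = (\<Sum>j<n. A i j * h k j) + q (Suc k) * b i)"
proof -
  define w where "w = rec_nat b (\<lambda>_ f i. \<Sum>j<n. A i j * f j)"
  have w: "w 0 = b" "\<And>k i. w (Suc k) i = (\<Sum>j<n. A i j * w k j)"
    by (simp_all add: w_def)
  obtain p where p: "\<exists>k\<le>n. p k \<noteq> 0" "\<And>i. i < n \<Longrightarrow> (\<Sum>k\<le>n. p k * w k i) = 0"
    using linear_dependence[of n w] by blast
  \<comment> \<open>The last nonzero coefficient of a dependence between b, A b, ...,
    \<open>A ^ n * b\<close>; dividing by it makes the annihilating polynomial monic.\<close>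
  define d where "d = Max {k. k \<le> n \<and> p k \<noteq> 0}"
  have "d \<in> {k. k \<le> n \<and> p k \<noteq> 0}"
    unfolding d_def using p(1) by (intro Max_in) auto
  then have d: "d \<le> n" "p d \<noteq> 0"
    by auto
  have zero: "p k = 0" if "d < k" "k \<le> n" for k
  proof (rule ccontr)
    assume "p k \<noteq> 0"
    then have "k \<le> d"
      unfolding d_def using that by (intro Max_ge) auto
    then show False using that by simp
  qed
  have sum_d: "(\<Sum>k\<le>d. p k * w k i) = 0" if "i < n" for i
  proof -
    have "(\<Sum>k\<le>d. p k * w k i) = (\<Sum>k\<le>n. p k * w k i)"
      using d zero by (intro sum.mono_neutral_left) auto
    then show ?thesis
      using p(2)[OF that] by simp
  qed
  have "0 < d"
  proof (rule ccontr)
    assume "\<not> 0 < d"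
    then show False
      using sum_d b d(2) w(1) by auto
  qed
  \<comment> \<open>Coefficients in descending order. Beyond \<open>d\<close> truncated subtraction
    repeats the lowest one; the recursion for \<open>h\<close> holds for any such
    continuation.\<close>
  define q where "q k = p (d - k) / p d" for k
  define h where "h m i = (\<Sum>k\<le>m. q k * w (m - k) i)" for m i
  have "h (Suc m) i = (\<Sum>j<n. A i j * h m j) + q (Suc m) * b i" for m i
  proof -
    have "h (Suc m) i = (\<Sum>k\<le>m. q k * w (Suc (m - k)) i) + q (Suc m) * b i"
      unfolding h_def using w(1) by (simp add: Suc_diff_le)
    also have "(\<Sum>k\<le>m. q k * w (Suc (m - k)) i) = (\<Sum>j<n. A i j * h m j)"
      unfolding h_def w(2) sum_distrib_left by (subst sum.swap) (simp add: algebra_simps)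
    finally show ?thesis .
  qed
  moreover have "h d i = 0" if "i < n" for i
  proof -
    have "h d i = (\<Sum>k\<le>d. p (d - k) * w (d - k) i) / p d"
      unfolding h_def q_def sum_divide_distrib by simp
    also have "(\<Sum>k\<le>d. p (d - k) * w (d - k) i) = (\<Sum>k\<le>d. p k * w k i)"
      by (rule sum.reindex_bij_witness[of _ "\<lambda>k. d - k" "\<lambda>k. d - k"]) auto
    finally show ?thesis
      using sum_d[OF that] by simp
  qed
  moreover have "h 0 = b" "q 0 = 1"
    using d w(1) by (auto simp: h_def q_def)
  ultimately show ?thesis
    using \<open>0 < d\<close> by blast
qed

section \<open>Criteria for and against controllability\<close>

lemma mult_mat_vec_nth:
  assumes "A \<in> carrier_mat n m" "x \<in> carrier_vec m" "i < n"
  shows "(A *\<^sub>v x) $ i = (\<Sum>j<m. A $$ (i, j) * x $ j)"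
  using assms by (simp add: scalar_prod_def row_def atLeast0LessThan)

text \<open>With \<open>y k\<close> as the k-th derivative of a function, this is x' = A x + b u for
  the state built from the \<open>h k\<close> and the input built from the \<open>q k\<close> (y is
  a flat output). Since A maps \<open>h k\<close> to \<open>h (Suc k) - q (Suc k) * b\<close>, the
  sums shift by one; the boundary terms cancel by \<open>h0\<close> and \<open>q0\<close>, or vanish
  by \<open>hd\<close>.\<close>

lemma horner_trajectory:
  fixes y :: "nat \<Rightarrow> real"
  assumes h0: "h 0 = b" and q0: "q 0 = 1" and hd: "h d i = 0"
    and rec: "\<And>k. h (Suc k) i = (\<Sum>l<n. A i l * h k l) + q (Suc k) * b i"
  shows "(\<Sum>k<d. h k i * y (d - k)) =
    (\<Sum>l<n. A i l * (\<Sum>k<d. h k l * y (d - Suc k))) + b i * (\<Sum>k\<le>d. q k * y (d - k))"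
proof -
  have "(\<Sum>l<n. A i l * (\<Sum>k<d. h k l * y (d - Suc k))) =
      (\<Sum>k<d. (\<Sum>l<n. A i l * h k l) * y (d - Suc k))"
    unfolding sum_distrib_left sum_distrib_right by (subst sum.swap) (simp add: mult.assoc)
  also have "\<dots> = (\<Sum>k<d. h (Suc k) i * y (d - Suc k)) - b i * (\<Sum>k<d. q (Suc k) * y (d - Suc k))"
    unfolding rec by (simp add: algebra_simps sum.distrib sum_distrib_left)
  also have "(\<Sum>k<d. h (Suc k) i * y (d - Suc k)) = (\<Sum>k<Suc d. h k i * y (d - k)) - h 0 i * y d"
    by (subst sum.lessThan_Suc_shift) simp
  also have "(\<Sum>k<d. q (Suc k) * y (d - Suc k)) = (\<Sum>k<Suc d. q k * y (d - k)) - q 0 * y d"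
    by (subst sum.lessThan_Suc_shift) simp
  also have "(\<Sum>k<Suc d. h k i * y (d - k)) = (\<Sum>k<d. h k i * y (d - k))"
    using hd by simp
  finally show ?thesis
    using h0 q0 by (simp add: lessThan_Suc_atMost algebra_simps)
qed

text \<open>
  The trajectories of \<open>horner_trajectory\<close> depend on one polynomial \<open>y\<close> per input, whose derivatives
  at the times 0 and 1 can be prescribed.  They reach every state because the vectors \<open>h k\<close> of all
  inputs together span the space: a vector orthogonal to all of them is unobservable.
\<close>

lemma controllable_if_observable:
  fixes A B :: "real mat"
  assumes A: "A \<in> carrier_mat n n" and B: "B \<in> carrier_mat n m"
    and nz: "\<And>j. j < m \<Longrightarrow> \<exists>i<n. B $$ (i, j) \<noteq> 0"
    and obs: "\<And>\<eta> :: nat \<Rightarrow> real.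
      (\<And>k j. j < m \<Longrightarrow> (\<Sum>i<n. B $$ (i, j) * ((\<lambda>\<zeta> i. \<Sum>l<n. A $$ (l, i) * \<zeta> l) ^^ k) \<eta> i) = 0) \<Longrightarrow>
      \<forall>i<n. \<eta> i = 0"
  shows "controllable A B"
proof -
  \<comment> \<open>\<open>D\<close> is the transpose of \<open>A\<close>, so \<open>obs\<close> is
    observability of the dual system.\<close>
  define D where "D = (\<lambda>(\<zeta> :: nat \<Rightarrow> real) i. \<Sum>l<n. A $$ (l, i) * \<zeta> l)"
  have D: "D \<zeta> i = (\<Sum>l<n. A $$ (l, i) * \<zeta> l)" for \<zeta> i
    by (simp add: D_def)
  have "\<forall>j\<in>{..<m}. \<exists>d h q. 0 < d \<and> h 0 = (\<lambda>i. B $$ (i, j)) \<and> q 0 = (1 :: real) \<and> (\<forall>i<n. h d i = 0) \<and>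
    (\<forall>k i. h (Suc k) i = (\<Sum>l<n. A $$ (i, l) * h k l) + q (Suc k) * B $$ (i, j))"
    using nz by (intro ballI horner_sequence) auto
  then obtain d h q where "\<forall>j\<in>{..<m}. 0 < d j \<and> h j 0 = (\<lambda>i. B $$ (i, j)) \<and> q j 0 = (1 :: real) \<and>
    (\<forall>i<n. h j (d j) i = 0) \<and>
    (\<forall>k i. h j (Suc k) i = (\<Sum>l<n. A $$ (i, l) * h j k l) + q j (Suc k) * B $$ (i, j))"
    unfolding bchoice_iff by blast
  then have d: "0 < d j" and h0: "h j 0 = (\<lambda>i. B $$ (i, j))" and q0: "q j 0 = 1"
    and hd: "i < n \<Longrightarrow> h j (d j) i = 0"
    and rec: "h j (Suc k) i = (\<Sum>l<n. A $$ (i, l) * h j k l) + q j (Suc k) * B $$ (i, j)"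
    if "j < m" for i j k
    using that by blast+
  define I where "I = Sigma {..<m} (\<lambda>j. {..<d j})"
  have span: "\<exists>c. \<forall>i<n. x i = (\<Sum>jk\<in>I. h (fst jk) (snd jk) i * c jk)" for x
  proof (rule spanning_if_no_normal)
    show "finite I"
      unfolding I_def by auto
  next
    fix \<eta> assume normal: "\<And>jk. jk \<in> I \<Longrightarrow> (\<Sum>i<n. h (fst jk) (snd jk) i * \<eta> i) = 0"
    \<comment> \<open>Each step of the induction moves one \<open>D\<close> over to
      \<open>h j k\<close> as an \<open>A\<close>, which the recursion turns into
      \<open>h j (Suc k)\<close> and \<open>h j 0\<close>. The index may reach \<open>d j\<close>,
      where the vector is 0.\<close>
    have orth: "(\<Sum>i<n. h j k i * (D ^^ t) \<eta> i) = 0" if "j < m" "k < d j" for t j k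
      using that
    proof (induction t arbitrary: k)
      case 0
      then show ?case
        using normal[of "(j, k)"] by (simp add: I_def)
    next
      case (Suc t)
      let ?\<zeta> = "(D ^^ t) \<eta>"
      have "(\<Sum>i<n. h j k i * (D ^^ Suc t) \<eta> i) = (\<Sum>i<n. (\<Sum>l<n. A $$ (i, l) * h j k l) * ?\<zeta> i)"
        unfolding funpow.simps comp_apply D[of ?\<zeta>] sum_distrib_left sum_distrib_right
        by (subst sum.swap) (simp add: algebra_simps)
      also have "\<dots> = (\<Sum>i<n. h j (Suc k) i * ?\<zeta> i) - q j (Suc k) * (\<Sum>i<n. h j 0 i * ?\<zeta> i)"
        unfolding rec[OF Suc.prems(1)] h0[OF Suc.prems(1)]
        by (simp add: algebra_simps sum.distrib sum_distrib_left)
      also have "(\<Sum>i<n. h j 0 i * ?\<zeta> i) = 0"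
        using Suc.IH[of 0] d Suc.prems by simp
      also have "(\<Sum>i<n. h j (Suc k) i * ?\<zeta> i) = 0"
        using Suc.IH[of "Suc k"] Suc.prems hd[OF Suc.prems(1)] by (cases "Suc k = d j") auto
      finally show ?case
        by simp
    qed
    show "\<forall>i<n. \<eta> i = 0"
      by (rule obs) (use orth[of _ 0] d h0 in \<open>simp add: D_def\<close>)
  qed
  show ?thesis
    unfolding controllable_def
  proof (intro ballI)
    fix x0 x1 :: "real vec" assume x: "x0 \<in> carrier_vec (dim_row A)" "x1 \<in> carrier_vec (dim_row A)"
    obtain c0 where c0: "\<And>i. i < n \<Longrightarrow> x0 $ i = (\<Sum>jk\<in>I. h (fst jk) (snd jk) i * c0 jk)"
      using span[of "\<lambda>i. x0 $ i"] by blast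
    obtain c1 where c1: "\<And>i. i < n \<Longrightarrow> x1 $ i = (\<Sum>jk\<in>I. h (fst jk) (snd jk) i * c1 jk)"
      using span[of "\<lambda>i. x1 $ i"] by blast
    \<comment> \<open>In the state, \<open>h j k\<close> is multiplied by the derivative of order
      \<open>d j - Suc k\<close>, hence the reversed index of the coefficients.\<close>
    have "\<forall>j. \<exists>p :: real poly. (\<forall>k<d j. poly ((pderiv ^^ k) p) 0 = c0 (j, d j - Suc k)) \<and>
        (\<forall>k<d j. poly ((pderiv ^^ k) p) 1 = c1 (j, d j - Suc k))"
      by (intro allI hermite_interpolation)
    then obtain p :: "nat \<Rightarrow> real poly" where
      p: "\<And>j k. k < d j \<Longrightarrow> poly ((pderiv ^^ k) (p j)) 0 = c0 (j, d j - Suc k)"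
        "\<And>j k. k < d j \<Longrightarrow> poly ((pderiv ^^ k) (p j)) 1 = c1 (j, d j - Suc k)"
      unfolding choice_iff by blast
    define Y where "Y j k t = poly ((pderiv ^^ k) (p j)) t" for j k t
    have Y': "((\<lambda>t. Y j k t) has_real_derivative Y j (Suc k) t) (at t within S)" for j k t S
      unfolding Y_def by (auto intro: DERIV_subset[OF poly_DERIV])
    define xi where "xi t i = (\<Sum>j<m. \<Sum>k<d j. h j k i * Y j (d j - Suc k) t)" for t i
    define ui where "ui t j = (\<Sum>k\<le>d j. q j k * Y j (d j - k) t)" for t j
    have "trajectory A B 1 (\<lambda>t. vec m (ui t)) (\<lambda>t. vec n (xi t))"
      unfolding trajectory_def
    proof (intro conjI ballI allI impI)
      fix j assume "j < dim_col B"
      then show "continuous_on {0..1} (\<lambda>t. vec m (ui t) $ j)"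
        using B unfolding ui_def Y_def by (auto intro!: continuous_intros)
    next
      fix t :: real and i assume i: "i < dim_row A"
      have "(A *\<^sub>v vec n (xi t) + B *\<^sub>v vec m (ui t)) $ i =
          (\<Sum>l<n. A $$ (i, l) * xi t l) + (\<Sum>j<m. B $$ (i, j) * ui t j)"
        using mult_mat_vec_nth[OF A, of "vec n (xi t)" i] mult_mat_vec_nth[OF B, of "vec m (ui t)" i]
          A B i by simp
      also have "(\<Sum>l<n. A $$ (i, l) * xi t l) =
          (\<Sum>j<m. \<Sum>l<n. A $$ (i, l) * (\<Sum>k<d j. h j k l * Y j (d j - Suc k) t))"
        unfolding xi_def sum_distrib_left[of _ _ "{..<m}"] by (rule sum.swap)
      also have "\<dots> + (\<Sum>j<m. B $$ (i, j) * ui t j) = (\<Sum>j<m. \<Sum>k<d j. h j k i * Y j (d j - k) t)"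
        unfolding sum.distrib[symmetric] ui_def
      proof (rule sum.cong[OF refl], rule sym)
        fix j assume "j \<in> {..<m}"
        then have j: "j < m" by simp
        show "(\<Sum>k<d j. h j k i * Y j (d j - k) t) =
          (\<Sum>l<n. A $$ (i, l) * (\<Sum>k<d j. h j k l * Y j (d j - Suc k) t)) +
          B $$ (i, j) * (\<Sum>k\<le>d j. q j k * Y j (d j - k) t)"
          using horner_trajectory[where h="h j" and d="d j" and q="q j" and i=i and n=n
              and b="\<lambda>i. B $$ (i, j)" and A="\<lambda>i l. A $$ (i, l)" and y="\<lambda>k. Y j k t"]
            h0[OF j] q0[OF j] hd[OF j] rec[OF j] i A by simp
      qed
      finally have rhs: "(A *\<^sub>v vec n (xi t) + B *\<^sub>v vec m (ui t)) $ i =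
          (\<Sum>j<m. \<Sum>k<d j. h j k i * Y j (d j - k) t)" .
      have term': "((\<lambda>s. h j k i * Y j (d j - Suc k) s) has_real_derivative h j k i * Y j (d j - k) t)
          (at t within {0..1})" if "k < d j" for j k
        using DERIV_cmult[OF Y'[of j "d j - Suc k" t "{0..1}"], of "h j k i"] that
        by (simp add: Suc_diff_Suc)
      have "((\<lambda>s. xi s i) has_real_derivative (\<Sum>j<m. \<Sum>k<d j. h j k i * Y j (d j - k) t))
          (at t within {0..1})"
        unfolding xi_def using term' by (intro DERIV_sum) auto
      then show "((\<lambda>s. vec n (xi s) $ i) has_real_derivative
          (A *\<^sub>v vec n (xi t) + B *\<^sub>v vec m (ui t)) $ i) (at t within {0..1})"
        unfolding rhs using i A by simp
    qed (use A B in auto)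
    moreover have "vec n (xi 0) = x0"
    proof (rule eq_vecI)
      fix i assume "i < dim_vec x0"
      then have i: "i < n" using x A by simp
      have "xi 0 i = (\<Sum>j<m. \<Sum>k<d j. h j k i * c0 (j, k))"
        unfolding xi_def Y_def using p(1) by (intro sum.cong refl) (simp add: Suc_diff_Suc)
      then show "vec n (xi 0) $ i = x0 $ i"
        using c0[OF i] i by (simp add: I_def sum.Sigma split_def)
    qed (use x A in simp)
    moreover have "vec n (xi 1) = x1"
    proof (rule eq_vecI)
      fix i assume "i < dim_vec x1"
      then have i: "i < n" using x A by simp
      have "xi 1 i = (\<Sum>j<m. \<Sum>k<d j. h j k i * c1 (j, k))"
        unfolding xi_def Y_def using p(2) by (intro sum.cong refl) (simp add: Suc_diff_Suc)
      then show "vec n (xi 1) $ i = x1 $ i"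
        using c1[OF i] i by (simp add: I_def sum.Sigma split_def)
    qed (use x A in simp)
    ultimately show "\<exists>T>0. \<exists>u x. trajectory A B T u x \<and> x 0 = x0 \<and> x T = x1"
      by (intro exI[of _ 1]) auto
  qed
qed

lemma uncontrollable_twins:
  assumes A: "A \<in> carrier_mat n n" and B: "B \<in> carrier_mat n m" and ij: "i < n" "j < n" "i \<noteq> j"
    and row: "\<And>x. x \<in> carrier_vec n \<Longrightarrow> (A *\<^sub>v x) $ i - (A *\<^sub>v x) $ j = \<mu> * (x $ i - x $ j)"
    and B0: "\<And>k. k < m \<Longrightarrow> B $$ (i, k) = 0" "\<And>k. k < m \<Longrightarrow> B $$ (j, k) = 0"
  shows "\<not> controllable A B"
proof
  assume "controllable A B"
  then have "\<forall>x1\<in>carrier_vec n. \<exists>T>0. \<exists>u x. trajectory A B T u x \<and> x 0 = 0\<^sub>v n \<and> x T = x1"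
    using A unfolding controllable_def by simp
  then obtain T u x where T: "T > 0" and tr: "trajectory A B T u x"
    and x0: "x 0 = 0\<^sub>v n" and xT: "x T = unit_vec n i"
    using unit_vec_carrier[of n i] by blast
  \<comment> \<open>With this integrating factor the difference of the two components becomes
    constant: it is 0 at the start but would have to be nonzero at time \<open>T\<close>.\<close>
  define y where "y t = (x t $ i - x t $ j) * exp (- \<mu> * t)" for t
  have y': "(y has_real_derivative 0) (at t within {0..T})" if t: "t \<in> {0..T}" for t
  proof -
    have car: "x t \<in> carrier_vec n" "u t \<in> carrier_vec m"
      using tr t A B unfolding trajectory_def by auto
    have der: "((\<lambda>s. x s $ k) has_real_derivative (A *\<^sub>v x t + B *\<^sub>v u t) $ k) (at t within {0..T})"
      if "k < n" for k
      using tr t that A unfolding trajectory_def by auto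
    have Bu: "(B *\<^sub>v u t) $ i = 0" "(B *\<^sub>v u t) $ j = 0"
      using mult_mat_vec_nth[OF B car(2)] ij B0 by simp_all
    have sub: "(A *\<^sub>v x t + B *\<^sub>v u t) $ i - (A *\<^sub>v x t + B *\<^sub>v u t) $ j = \<mu> * (x t $ i - x t $ j)"
      using row[OF car(1)] Bu ij A B by simp
    have "(y has_real_derivative
        ((A *\<^sub>v x t + B *\<^sub>v u t) $ i - (A *\<^sub>v x t + B *\<^sub>v u t) $ j) * exp (- \<mu> * t) +
        (exp (- \<mu> * t) * (- \<mu>)) * (x t $ i - x t $ j)) (at t within {0..T})"
      unfolding y_def
      by (rule DERIV_mult[OF DERIV_diff[OF der[OF ij(1)] der[OF ij(2)]]])
        (auto intro!: derivative_eq_intros)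
    then show ?thesis
      unfolding sub by (simp add: algebra_simps)
  qed
  have "y T = y 0"
  proof (rule DERIV_isconst_end[OF T])
    show "continuous_on {0..T} y"
      using y' by (rule DERIV_continuous_on)
    show "DERIV y t :> 0" if "0 < t" "t < T" for t
      using y'[of t] at_within_Icc_at[OF that] that by simp
  qed
  then show False
    using x0 xT ij by (simp add: y_def)
qed


section \<open>Laplacians along the cotree\<close>

primrec flip :: "label \<Rightarrow> label" where
  "flip Label0 = Label1"
| "flip Label1 = Label0"

lemma flip: "c \<noteq> b \<longleftrightarrow> c = flip b"
  by (cases b; cases c) auto

text \<open>
  The Laplacian of the graph induced on \<open>S\<close> (label 1) or of the complement of that graph (label 0).
\<close>

definition lap :: "'a rel \<Rightarrow> label \<Rightarrow> 'a set \<Rightarrow> ('a \<Rightarrow> real) \<Rightarrow> 'a \<Rightarrow> real" where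
  "lap E c S \<eta> u =
     (\<Sum>w\<in>S. if w \<noteq> u \<and> ((u, w) \<in> E \<longleftrightarrow> c = Label1) then \<eta> u - \<eta> w else 0)"

lemma lap_linear:
  "lap E c S (\<lambda>u. \<alpha> * \<eta> u + \<beta> * \<zeta> u) u = \<alpha> * lap E c S \<eta> u + \<beta> * lap E c S \<zeta> u"
  unfolding lap_def sum_distrib_left sum.distrib[symmetric]
  by (intro sum.cong refl) (auto simp: algebra_simps)

lemma lap_cong: "u \<in> S \<Longrightarrow> (\<And>w. w \<in> S \<Longrightarrow> \<eta> w = \<zeta> w) \<Longrightarrow> lap E c S \<eta> u = lap E c S \<zeta> u"
  unfolding lap_def by (intro sum.cong refl) auto

text \<open>The Laplacians of a graph and of its complement add up to that of the complete graph,
  the identity times \<open>card S\<close> minus the all-ones matrix.\<close>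

lemma lap_flip:
  "lap E (flip c) S \<eta> u = real (card S) * \<eta> u - sum \<eta> S - lap E c S \<eta> u"
proof -
  have "lap E c S \<eta> u + lap E (flip c) S \<eta> u = (\<Sum>w\<in>S. \<eta> u - \<eta> w)"
    unfolding lap_def sum.distrib[symmetric] by (intro sum.cong refl) (cases c; auto)
  then show ?thesis
    by (simp add: sum_subtractf)
qed

lemma sum_lap:
  assumes "sym E"
  shows "(\<Sum>u\<in>S. lap E c S \<eta> u) = 0"
proof -
  let ?g = "\<lambda>u w. if w \<noteq> u \<and> ((u, w) \<in> E \<longleftrightarrow> c = Label1) then \<eta> u - \<eta> w else 0"
  have g: "?g u w = - ?g w u" for u w
    using symD[OF assms] by auto
  have "(\<Sum>u\<in>S. \<Sum>w\<in>S. ?g u w) = (\<Sum>u\<in>S. \<Sum>w\<in>S. - ?g w u)"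
    by (intro sum.cong refl g)
  also have "\<dots> = - (\<Sum>u\<in>S. \<Sum>w\<in>S. ?g u w)"
    unfolding sum_negf by (subst sum.swap) simp
  finally show ?thesis
    unfolding lap_def by linarith
qed

text \<open>Twice the quadratic form of the Laplacian is the sum of the squares of \<eta> u - \<eta>
  w over ordered adjacent pairs; if the form is 0, every square is.\<close>

lemma lap_eq_0_imp_const:
  assumes "sym E" "finite S" and zero: "\<And>u. u \<in> S \<Longrightarrow> lap E c S \<eta> u = 0"
    and uw: "u \<in> S" "w \<in> S" "u \<noteq> w" "(u, w) \<in> E \<longleftrightarrow> c = Label1"
  shows "\<eta> u = \<eta> w"
proof -
  let ?k = "\<lambda>u w. w \<noteq> u \<and> ((u, w) \<in> E \<longleftrightarrow> c = Label1)"
  let ?g = "\<lambda>u w. if ?k u w then \<eta> u * (\<eta> u - \<eta> w) else 0"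
  let ?q = "\<lambda>u w. if ?k u w then (\<eta> u - \<eta> w)\<^sup>2 else 0"
  have "(\<Sum>u\<in>S. \<eta> u * lap E c S \<eta> u) = (\<Sum>u\<in>S. \<Sum>w\<in>S. ?g u w)"
    unfolding lap_def sum_distrib_left by (intro sum.cong refl) auto
  then have 0: "(\<Sum>u\<in>S. \<Sum>w\<in>S. ?g u w) = 0"
    using zero by simp
  have q: "?q u w = ?g u w + ?g w u" for u w
    using symD[OF assms(1)] by (auto simp: power2_eq_square algebra_simps)
  have "(\<Sum>u\<in>S. \<Sum>w\<in>S. ?q u w) = (\<Sum>u\<in>S. \<Sum>w\<in>S. ?g u w + ?g w u)"
    by (intro sum.cong refl q)
  also have "\<dots> = (\<Sum>u\<in>S. \<Sum>w\<in>S. ?g u w) + (\<Sum>u\<in>S. \<Sum>w\<in>S. ?g w u)"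
    by (simp only: sum.distrib)
  also have "(\<Sum>u\<in>S. \<Sum>w\<in>S. ?g w u) = (\<Sum>u\<in>S. \<Sum>w\<in>S. ?g u w)"
    by (rule sum.swap)
  finally have "(\<Sum>u\<in>S. \<Sum>w\<in>S. ?q u w) = 0"
    using 0 by simp
  then have "(\<Sum>w\<in>S. ?q u w) = 0"
    using assms(2) uw(1) by (subst (asm) sum_nonneg_eq_0_iff) (auto intro!: sum_nonneg)
  then have "?q u w = 0"
    using assms(2) uw(2) by (subst (asm) sum_nonneg_eq_0_iff) auto
  then show ?thesis
    using uw(3,4) by (auto split: if_splits)
qed

text \<open>Pairs between different children are related according to \<open>b\<close>, so the
  opposite Laplacian is block diagonal over the children.\<close>

lemma lap_child:
  assumes "cotree_node E b ts" "t \<in> fset ts" "u \<in> leaves t"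
  shows "lap E (flip b) (leaves (Node b ts)) \<eta> u = lap E (flip b) (leaves t) \<eta> u"
  unfolding lap_def
proof (rule sum.mono_neutral_right)
  show "finite (leaves (Node b ts))"
    by (rule finite_leaves)
  show "leaves t \<subseteq> leaves (Node b ts)"
    using assms(2) by auto
  show "\<forall>w\<in>leaves (Node b ts) - leaves t.
      (if w \<noteq> u \<and> ((u, w) \<in> E \<longleftrightarrow> flip b = Label1) then \<eta> u - \<eta> w else 0) = 0"
  proof
    fix w assume w: "w \<in> leaves (Node b ts) - leaves t"
    then obtain s where s: "s \<in> fset ts" "w \<in> leaves s"
      by auto
    then have "t \<noteq> s"
      using w by blast
    then have "(u, w) \<in> E \<longleftrightarrow> b = Label1"
      using arc_iff[OF assms(1,2) s(1)] assms(3) s(2) by blast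
    then show "(if w \<noteq> u \<and> ((u, w) \<in> E \<longleftrightarrow> flip b = Label1) then \<eta> u - \<eta> w else 0) = 0"
      by (cases b) auto
  qed
qed

section \<open>Invariant sets of functions on the leaves\<close>

definition covers :: "'a set \<Rightarrow> 'a ltree \<Rightarrow> bool" where
  "covers C T \<longleftrightarrow> (\<forall>b ts u v. Node b ts \<in> subtrees T \<longrightarrow> Leaf u \<in> fset ts \<longrightarrow>
     Leaf v \<in> fset ts \<longrightarrow> u \<noteq> v \<longrightarrow> u \<in> C \<or> v \<in> C)"

lemma covers_child: "covers C (Node b ts) \<Longrightarrow> t \<in> fset ts \<Longrightarrow> covers C t"
  unfolding covers_def by (simp, blast)

text \<open>Descending through inner children ends at two sibling leaves, one of which is in
  \<open>C\<close>.\<close>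

lemma covers_Node_leaf:
  assumes "represents E (Node b ts)" "covers C (Node b ts)"
  shows "\<exists>u\<in>leaves (Node b ts). u \<in> C"
proof -
  have "\<exists>u\<in>leaves T. u \<in> C" if "represents E T" "covers C T" "\<nexists>v. T = Leaf v" for T
    using that
  proof (induction T)
    case (Node b ts)
    have node: "cotree_node E b ts"
      using Node.prems(1) by simp
    have "fset ts \<noteq> {}"
      using node by (auto simp: cotree_node_def fcard.rep_eq)
    then obtain s t where st: "s \<in> fset ts" "t \<in> fset ts" "t \<noteq> s"
      using other_child[OF node] by blast
    show ?case
    proof (cases "\<exists>u v. s = Leaf u \<and> t = Leaf v")
      case True
      then obtain u v where uv: "s = Leaf u" "t = Leaf v"
        by blast
      then have "u \<in> C \<or> v \<in> C"
        using Node.prems(2) st unfolding covers_def by auto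
      moreover have "u \<in> leaves (Node b ts)" "v \<in> leaves (Node b ts)"
        using st uv leaf_in_leaves by metis+
      ultimately show ?thesis by blast
    next
      case False
      then obtain r where r: "r \<in> fset ts" "\<nexists>v. r = Leaf v"
        using st by blast
      have "represents E r"
        using Node.prems(1) r(1) by simp
      then obtain u where "u \<in> leaves r" "u \<in> C"
        using Node.IH[OF r(1)] covers_child[OF Node.prems(2) r(1)] r(2) by blast
      then show ?thesis
        using child_in_leaves[OF r(1)] by blast
    qed
  qed simp
  then show ?thesis
    using assms by blast
qed

text \<open>
  Closure is only required up to values outside \<open>S\<close>, so that one set of functions can be
  considered on several sets of leaves.
\<close>

definition lap_closed :: "'a rel \<Rightarrow> label \<Rightarrow> 'a set \<Rightarrow> ('a \<Rightarrow> real) set \<Rightarrow> bool" where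
  "lap_closed E c S W \<longleftrightarrow>
     (\<forall>\<eta>\<in>W. \<forall>\<alpha> \<beta>. \<exists>\<zeta>\<in>W. \<forall>u\<in>S. \<zeta> u = \<alpha> * \<eta> u + \<beta> * lap E c S \<eta> u)"

text \<open>For sum 0 the all-ones term of \<open>lap_flip\<close> vanishes. The identity term that
  remains is the reason for the summand \<alpha> * \<eta> u in \<open>lap_closed\<close>.\<close>

lemma lap_closed_flip:
  assumes "lap_closed E c S W" and "\<And>\<eta>. \<eta> \<in> W \<Longrightarrow> sum \<eta> S = 0"
  shows "lap_closed E (flip c) S W"
  unfolding lap_closed_def
proof (intro ballI allI)
  fix \<eta> \<alpha> \<beta> assume \<eta>: "\<eta> \<in> W"
  then obtain \<zeta> where "\<zeta> \<in> W"
    "\<forall>u\<in>S. \<zeta> u = (\<alpha> + \<beta> * real (card S)) * \<eta> u + (- \<beta>) * lap E c S \<eta> u"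
    using assms(1) unfolding lap_closed_def by blast
  then show "\<exists>\<zeta>\<in>W. \<forall>u\<in>S. \<zeta> u = \<alpha> * \<eta> u + \<beta> * lap E (flip c) S \<eta> u"
    using assms(2)[OF \<eta>] by (intro bexI[of _ \<zeta>]) (auto simp: lap_flip algebra_simps)
qed

text \<open>Passing to images under \<open>lap\<close> is what creates sum 0, by
  \<open>sum_lap\<close>. Applied with \<open>S'\<close> the leaves of a child, and at the root with
  \<open>S'\<close> equal to \<open>S\<close>.\<close>

lemma lap_closed_lap:
  assumes "lap_closed E c S W" and "S' \<subseteq> S"
    and S': "\<And>\<eta> u. u \<in> S' \<Longrightarrow> lap E c S \<eta> u = lap E c S' \<eta> u"
  shows "lap_closed E c S' (lap E c S ` W)"
  unfolding lap_closed_def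
proof (intro ballI allI)
  fix \<theta> \<alpha> \<beta> assume "\<theta> \<in> lap E c S ` W"
  then obtain \<eta> where \<eta>: "\<eta> \<in> W" "\<theta> = lap E c S \<eta>"
    by blast
  obtain \<zeta> where \<zeta>: "\<zeta> \<in> W" "\<forall>u\<in>S. \<zeta> u = \<alpha> * \<eta> u + \<beta> * lap E c S \<eta> u"
    using assms(1) \<eta>(1) unfolding lap_closed_def by blast
  have "lap E c S \<zeta> u = \<alpha> * \<theta> u + \<beta> * lap E c S' \<theta> u" if "u \<in> S'" for u
  proof -
    have "lap E c S \<zeta> u = lap E c S (\<lambda>u. \<alpha> * \<eta> u + \<beta> * lap E c S \<eta> u) u"
      using \<zeta>(2) that assms(2) by (intro lap_cong) auto
    then show ?thesis
      unfolding lap_linear using S'[OF that] \<eta>(2) by simp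
  qed
  then show "\<exists>\<zeta>\<in>lap E c S ` W. \<forall>u\<in>S'. \<zeta> u = \<alpha> * \<theta> u + \<beta> * lap E c S' \<theta> u"
    using \<zeta>(1) by blast
qed

lemma lap_vanishes:
  assumes "lap_closed E c S W" "\<forall>\<eta>\<in>W. \<forall>u\<in>S \<inter> C. \<eta> u = 0"
    and "\<eta> \<in> W" "u \<in> S \<inter> C"
  shows "lap E c S \<eta> u = 0"
proof -
  obtain \<zeta> where "\<zeta> \<in> W" "\<forall>u\<in>S. \<zeta> u = 0 * \<eta> u + 1 * lap E c S \<eta> u"
    using assms(1,3) unfolding lap_closed_def by blast
  then show ?thesis
    using assms(2,4) by auto
qed

text \<open>
  On functions with sum 0 the Laplacians of a graph and of its complement generate the same
  algebra, so at a node labelled \<open>b\<close> we may use the one that does not connect different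
  children.  It maps \<open>W\<close> to functions with sum 0 on each child, which vanish by induction; hence
  the elements of \<open>W\<close> are constant on each child.
\<close>

lemma lap_closed_vanishes:
  assumes "represents E T" "sym E" "covers C T" "lap_closed E d (leaves T) W"
    and "\<And>\<eta>. \<eta> \<in> W \<Longrightarrow> sum \<eta> (leaves T) = 0"
    and "\<And>\<eta> u. \<eta> \<in> W \<Longrightarrow> u \<in> leaves T \<inter> C \<Longrightarrow> \<eta> u = 0"
    and "\<eta> \<in> W" "u \<in> leaves T"
  shows "\<eta> u = 0"
  using assms(1,3-)
proof (induction T arbitrary: W d \<eta> u)
  case (Leaf v)
  then show ?case
    using Leaf.prems(4)[of \<eta>] by simp
next
  case (Node b ts)
  let ?S = "leaves (Node b ts)"
  let ?c = "flip b"
  have node: "cotree_node E b ts"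
    using Node.prems(1) by simp
  \<comment> \<open>Either \<open>d\<close> already is \<open>flip b\<close>, or the zero sums allow
    the change to the complement.\<close>
  have closed: "lap_closed E ?c ?S W"
    using Node.prems(3) lap_closed_flip[OF Node.prems(3)] Node.prems(4) by (metis flip)
  have van: "\<forall>\<eta>\<in>W. \<forall>u\<in>?S \<inter> C. \<eta> u = 0"
    using Node.prems(5) by blast
  have sub: "leaves t \<subseteq> ?S" if "t \<in> fset ts" for t
    using that by auto
  have lap0: "lap E ?c (leaves t) \<zeta> v = 0"
    if t: "t \<in> fset ts" and v: "v \<in> leaves t" and \<zeta>: "\<zeta> \<in> W" for t v \<zeta>
  proof -
    have "lap E ?c ?S \<zeta> v = 0"
    proof (rule Node.IH[OF t])
      show "represents E t"
        using Node.prems(1) t by simp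
      show "covers C t"
        using covers_child[OF Node.prems(2) t] .
      show "lap_closed E ?c (leaves t) (lap E ?c ?S ` W)"
        using closed sub[OF t] lap_child[OF node t] by (rule lap_closed_lap)
      show "sum \<theta> (leaves t) = 0" if "\<theta> \<in> lap E ?c ?S ` W" for \<theta>
        using that lap_child[OF node t] sum_lap[OF assms(2)] by auto
      show "\<theta> w = 0" if "\<theta> \<in> lap E ?c ?S ` W" "w \<in> leaves t \<inter> C" for \<theta> w
        using that lap_vanishes[OF closed van] sub[OF t] by (auto simp del: ltree.set)
      show "lap E ?c ?S \<zeta> \<in> lap E ?c ?S ` W"
        using \<zeta> by blast
      show "v \<in> leaves t"
        by (rule v)
    qed
    then show ?thesis
      using lap_child[OF node t v] by metis
  qed
  \<comment> \<open>An inner child has label \<open>flip b\<close>, so it is connected for the very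
    relation whose Laplacian was shown to vanish; its constant value is 0 at a control node.\<close>
  have inner: "\<eta> v = 0" if t: "Node a xs \<in> fset ts" and v: "v \<in> leaves (Node a xs)" for a xs v
  proof -
    have a: "a = ?c"
      using node t unfolding cotree_node_def flip[symmetric] by blast
    have rep: "represents E (Node a xs)"
      using Node.prems(1) t unfolding represents_Node[of E b ts] by blast
    obtain w where w: "w \<in> leaves (Node a xs)" "w \<in> C"
      using covers_Node_leaf[OF rep covers_child[OF Node.prems(2) t]] by blast
    have "\<eta> v = \<eta> w"
      using rep _ v w(1)
    proof (rule node_connected)
      fix x y assume xy: "x \<in> leaves (Node a xs)" "y \<in> leaves (Node a xs)" "x \<noteq> y"
        "((x, y) \<in> E) = (a = Label1)"
      have "lap E a (leaves (Node a xs)) \<eta> z = 0" if "z \<in> leaves (Node a xs)" for z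
        using lap0[OF t that Node.prems(6)] unfolding a .
      then show "\<eta> x = \<eta> y"
        using xy by (rule lap_eq_0_imp_const[OF assms(2) finite_leaves])
    qed
    also have "\<eta> w = 0"
      using Node.prems(5)[OF Node.prems(6), of w] w sub[OF t] by blast
    finally show ?thesis .
  qed
  obtain t where t: "t \<in> fset ts" "u \<in> leaves t"
    using Node.prems(7) by auto
  show ?case
  proof (cases "t = Leaf u \<and> u \<notin> C")
    case True
    \<comment> \<open>Constancy says nothing about a single leaf. But by \<open>covers\<close>,
      \<open>u\<close> is the only leaf child outside \<open>C\<close>, so all other values are 0
      and the zero sum settles \<open>u\<close>.\<close>
    have "\<eta> v = 0" if v: "v \<in> ?S - {u}" for v
    proof -
      obtain s where s: "s \<in> fset ts" "v \<in> leaves s"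
        using v by auto
      show ?thesis
      proof (cases s)
        case (Leaf x)
        then have "v \<in> C"
          using s t True v Node.prems(2) unfolding covers_def by auto
        then show ?thesis
          using Node.prems(5)[OF Node.prems(6), of v] v by blast
      next
        case (Node a xs)
        then show ?thesis
          using inner s by blast
      qed
    qed
    then have "sum \<eta> ?S = \<eta> u"
      using sum.remove[OF finite_leaves Node.prems(7), of \<eta>] by simp
    then show ?thesis
      using Node.prems(4)[OF Node.prems(6)] by simp
  next
    case False
    show ?thesis
    proof (cases t)
      case (Leaf x)
      then have "u \<in> C"
        using False t by simp
      then show ?thesis
        using Node.prems(5)[OF Node.prems(6), of u] Node.prems(7) by blast
    next
      case (Node a xs)
      then show ?thesis
        using inner t by blast
    qed
  qed
qed

text \<open>\<open>W\<close> itself need not have zero sums, but its image under the Laplacian does.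
  So the Laplacian of \<eta> is 0, \<eta> is constant by \<open>conn\<close>, and a control node
  fixes the constant.\<close>

lemma connected_lap_closed_vanishes:
  assumes T: "represents E (Node b ts)" and S: "S = leaves (Node b ts)" and E: "sym E"
    and cov: "covers C (Node b ts)"
    and conn: "\<And>(f :: 'a \<Rightarrow> real) x y. (\<And>x y. (x, y) \<in> E \<Longrightarrow> f x = f y) \<Longrightarrow> x \<in> S \<Longrightarrow> y \<in> S \<Longrightarrow> f x = f y"
    and E_sub: "E \<subseteq> S \<times> S" and W: "lap_closed E Label1 S W"
    and van: "\<forall>\<eta>\<in>W. \<forall>u\<in>S \<inter> C. \<eta> u = 0"
    and \<eta>: "\<eta> \<in> W" and u: "u \<in> S"
  shows "\<eta> u = 0"
proof -
  have zero: "lap E Label1 S \<eta> v = 0" if "v \<in> S" for v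
  proof (rule lap_closed_vanishes[OF T E cov])
    show "lap_closed E Label1 (leaves (Node b ts)) (lap E Label1 S ` W)"
      using lap_closed_lap[OF W order_refl] unfolding S by blast
    show "sum \<theta> (leaves (Node b ts)) = 0" if "\<theta> \<in> lap E Label1 S ` W" for \<theta>
      using that sum_lap[OF E] unfolding S by blast
    show "\<theta> w = 0" if "\<theta> \<in> lap E Label1 S ` W" "w \<in> leaves (Node b ts) \<inter> C" for \<theta> w
      using that lap_vanishes[OF W van] unfolding S by (auto simp del: ltree.set)
  qed (use \<eta> that S in auto)
  obtain w where w: "w \<in> S" "w \<in> C"
    using covers_Node_leaf[OF T cov] S by blast
  have "\<eta> u = \<eta> w"
  proof (rule conn[OF _ u w(1)])
    fix x y assume "(x, y) \<in> E"
    moreover have "finite S"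
      unfolding S by (rule finite_leaves)
    ultimately show "\<eta> x = \<eta> y"
      using lap_eq_0_imp_const[OF E _ zero, of x y] E_sub by (cases "x = y") auto
  qed
  also have "\<eta> w = 0"
    using van \<eta> w by blast
  finally show ?thesis .
qed


section \<open>Controllability of the network\<close>

lemma laplacian_carrier: "laplacian n G \<in> carrier_mat n n"
  by (intro carrier_matI) (simp_all add: laplacian_def degree_matrix_def adjacency_matrix_def)

lemma input_matrix_carrier: "input_matrix n js \<in> carrier_mat n (length js)"
  by (simp add: input_matrix_def mat_of_cols_def)

lemma input_matrix_nth:
  "i < n \<Longrightarrow> k < length js \<Longrightarrow> js ! k - 1 < n \<Longrightarrow>
     input_matrix n js $$ (i, k) = (if i = js ! k - 1 then 1 else 0)"
  by (simp add: input_matrix_def mat_of_cols_def)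

lemma real_out_degree:
  assumes "parcs G \<subseteq> {1..n} \<times> {1..n}"
  shows "real (out_degree (with_proj G) u) = (\<Sum>l<n. if (u, Suc l) \<in> parcs G then 1 else 0)"
proof -
  have "out_arcs (with_proj G) u = (\<lambda>l. (u, Suc l)) ` {l\<in>{..<n}. (u, Suc l) \<in> parcs G}"
  proof -
    have "e \<in> (\<lambda>l. (u, Suc l)) ` {l\<in>{..<n}. (u, Suc l) \<in> parcs G}"
      if "e \<in> out_arcs (with_proj G) u" for e
      using that assms by (intro image_eqI[of _ _ "snd e - 1"]) (auto simp: out_arcs_def, fastforce)
    then show ?thesis
      by (auto simp: out_arcs_def)
  qed
  then have "out_degree (with_proj G) u = card {l\<in>{..<n}. (u, Suc l) \<in> parcs G}"
    unfolding out_degree_def by (simp add: card_image inj_on_def)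
  also have "real \<dots> = (\<Sum>l<n. if (u, Suc l) \<in> parcs G then 1 else 0)"
    by (simp add: sum.If_cases Int_def)
  finally show ?thesis .
qed

text \<open>The bridge from vectors indexed from 0 to functions on the nodes 1, ..., n: \<zeta>
  becomes \<open>\<lambda>w. \<zeta> (w - 1)\<close>.\<close>

lemma laplacian_row:
  assumes E: "parcs G \<subseteq> {1..n} \<times> {1..n}" "\<And>u. (u, u) \<notin> parcs G" and i: "i < n"
  shows "(\<Sum>l<n. (- laplacian n G) $$ (i, l) * \<zeta> l) =
    - lap (parcs G) Label1 {1..n} (\<lambda>w. \<zeta> (w - 1)) (Suc i)"
proof -
  let ?a = "\<lambda>l. if (Suc i, Suc l) \<in> parcs G then 1 else (0 :: real)"
  let ?d = "real (out_degree (with_proj G) (Suc i))"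
  have "(\<Sum>l<n. (- laplacian n G) $$ (i, l) * \<zeta> l) = (\<Sum>l<n. ?a l * \<zeta> l - (if i = l then ?d * \<zeta> l else 0))"
    using i by (intro sum.cong refl)
      (simp add: laplacian_def degree_matrix_def adjacency_matrix_def algebra_simps)
  also have "\<dots> = (\<Sum>l<n. ?a l * \<zeta> l) - ?d * \<zeta> i"
    using i by (simp add: sum_subtractf)
  also have "\<dots> = - (\<Sum>l<n. ?a l * (\<zeta> i - \<zeta> l))"
    unfolding real_out_degree[OF E(1)]
    by (simp add: right_diff_distrib sum_subtractf sum_distrib_right)
  also have "(\<Sum>l<n. ?a l * (\<zeta> i - \<zeta> l)) = lap (parcs G) Label1 {1..n} (\<lambda>w. \<zeta> (w - 1)) (Suc i)"
    unfolding lap_def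
    by (rule sum.reindex_bij_witness[of _ "\<lambda>w. w - 1" Suc]) (use E(2) in \<open>auto simp: Suc_le_eq\<close>)
  finally show ?thesis .
qed

lemma laplacian_symmetric:
  assumes "sym (parcs G)" "i < n" "l < n"
  shows "laplacian n G $$ (i, l) = laplacian n G $$ (l, i)"
  using assms symD[OF assms(1)]
  by (auto simp: laplacian_def degree_matrix_def adjacency_matrix_def)

text \<open>In the difference the values at third nodes cancel. So \<mu> is the number of common
  neighbours, in the relation selected by \<open>c\<close>, plus 2 if \<open>u\<close> and
  \<open>v\<close> are themselves related.\<close>

lemma lap_twins:
  assumes S: "finite S" "u \<in> S" "v \<in> S" "u \<noteq> v" and "sym E"
    and tw: "\<And>w. w \<in> S \<Longrightarrow> w \<noteq> u \<Longrightarrow> w \<noteq> v \<Longrightarrow> (u, w) \<in> E \<longleftrightarrow> (v, w) \<in> E"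
  shows "\<exists>\<mu>. \<forall>\<eta>. lap E c S \<eta> u - lap E c S \<eta> v = \<mu> * (\<eta> u - \<eta> v)"
proof -
  let ?R = "S - {u} - {v}"
  let ?k = "\<lambda>w. if (u, w) \<in> E \<longleftrightarrow> c = Label1 then 1 else (0 :: real)"
  have split: "sum f S = f u + (f v + sum f ?R)" for f :: "'a \<Rightarrow> real"
    using S by (simp add: sum.remove[of S u] sum.remove[of "S - {u}" v])
  have vu: "(v, u) \<in> E \<longleftrightarrow> (u, v) \<in> E"
    using symD[OF assms(5)] by blast
  have "lap E c S \<eta> u - lap E c S \<eta> v = (sum ?k ?R + 2 * ?k v) * (\<eta> u - \<eta> v)" for \<eta>
  proof -
    have "(\<Sum>w\<in>?R. if w \<noteq> u \<and> ((u, w) \<in> E \<longleftrightarrow> c = Label1) then \<eta> u - \<eta> w else 0) =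
        (\<Sum>w\<in>?R. ?k w * (\<eta> u - \<eta> w))"
      by (intro sum.cong refl) simp
    then have u: "lap E c S \<eta> u = ?k v * (\<eta> u - \<eta> v) + (\<Sum>w\<in>?R. ?k w * (\<eta> u - \<eta> w))"
      unfolding lap_def split using S(4) by simp
    have "(\<Sum>w\<in>?R. if w \<noteq> v \<and> ((v, w) \<in> E \<longleftrightarrow> c = Label1) then \<eta> v - \<eta> w else 0) =
        (\<Sum>w\<in>?R. ?k w * (\<eta> v - \<eta> w))"
      by (intro sum.cong refl) (simp add: tw)
    then have v: "lap E c S \<eta> v = ?k v * (\<eta> v - \<eta> u) + (\<Sum>w\<in>?R. ?k w * (\<eta> v - \<eta> w))"
      unfolding lap_def split using S(4) vu by simp
    show ?thesis
      unfolding u v by (simp add: algebra_simps sum_subtractf sum.distrib sum_distrib_left)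
  qed
  then show ?thesis
    by blast
qed

text \<open>Connectedness in the path-free form that \<open>connected_lap_closed_vanishes\<close>
  takes as \<open>conn\<close>.\<close>

lemma arcs_const_if_connected:
  assumes "Digraph_Component.connected (with_proj G)"
    and f: "\<And>x y. (x, y) \<in> parcs G \<Longrightarrow> f x = f y"
    and "u \<in> pverts G" "v \<in> pverts G"
  shows "f u = f v"
proof -
  have "(u, v) \<in> rtrancl_on (pverts G) (parcs (mk_symmetric (with_proj G)))"
    using assms(1,3,4) unfolding connected_def strongly_connected_def reachable_def by auto
  then have "(u, v) \<in> (parcs (mk_symmetric (with_proj G)))\<^sup>*"
    by (rule rtrancl_on_rtranclI)
  then show ?thesis
  proof induction
    case (step y z)
    then have "(y, z) \<in> parcs G \<or> (z, y) \<in> parcs G"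
      by (auto simp: parcs_mk_symmetric)
    then show ?case
      using step.IH f by metis
  qed simp
qed

lemma siblings_in_pverts:
  assumes "cograph G" "siblings G u v"
  shows "u \<in> pverts G \<and> v \<in> pverts G"
proof -
  have T: "leaves (cotree G) = pverts G" "represents (parcs G) (cotree G)"
    using cotree_is_cotree[OF assms(1)] by (simp_all add: is_cotree_iff)
  obtain c us where us: "Node c us \<in> subtrees (cotree G)" "Leaf u \<in> fset us" "Leaf v \<in> fset us"
    using assms(2) unfolding siblings_def by blast
  then show ?thesis
    using subtrees_represents[OF us(1) T(2)] leaf_in_leaves[OF us(2)] leaf_in_leaves[OF us(3)] T(1)
    by blast
qed

lemma network_controllable_iff:
  fixes n :: nat and G :: "nat pair_pre_digraph"
  assumes G: "pair_graph G" "pverts G = {1..n}" "n > 1"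
    "Digraph_Component.connected (with_proj G)" "cograph G"
    and js: "set js \<subseteq> {1..n}"
  shows "network_controllable n G js \<longleftrightarrow>
    (\<forall>u v. siblings G u v \<longrightarrow> u \<noteq> v \<longrightarrow> u \<in> set js \<or> v \<in> set js)"
proof -
  let ?E = "parcs G" and ?A = "- laplacian n G" and ?B = "input_matrix n js" and ?V = "{1..n}"
  interpret pair_graph G by (rule G(1))
  have E: "?E \<subseteq> ?V \<times> ?V" "\<And>u. (u, u) \<notin> ?E" "sym ?E"
    using G(2) in_arcsD1 in_arcsD2 pair_no_loops pair_sym_arcs
    by (fastforce, fastforce, simp add: symmetric_def)
  have A: "?A \<in> carrier_mat n n"
    using laplacian_carrier by simp
  have B: "?B \<in> carrier_mat n (length js)"
    by (rule input_matrix_carrier)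
  have js_nth: "js ! k \<in> ?V" "js ! k - 1 < n" if "k < length js" for k
    using js nth_mem[OF that] by (force+)
  have T: "leaves (cotree G) = ?V" "represents ?E (cotree G)"
    using cotree_is_cotree[OF G(5)] G(2) by (simp_all add: is_cotree_iff)
  obtain b ts where root: "cotree G = Node b ts"
  proof (cases "cotree G")
    case (Leaf v)
    then have "card ?V = 1"
      using T(1) by (metis card_1_singleton_iff ltree.set(1) One_nat_def)
    then show ?thesis using G(3) by simp
  qed
  have cov: "(\<forall>u v. siblings G u v \<longrightarrow> u \<noteq> v \<longrightarrow> u \<in> set js \<or> v \<in> set js) \<longleftrightarrow> covers (set js) (cotree G)"
    unfolding covers_def siblings_def by blast
  show ?thesis
  proof
    assume ctrl: "network_controllable n G js"
    show "\<forall>u v. siblings G u v \<longrightarrow> u \<noteq> v \<longrightarrow> u \<in> set js \<or> v \<in> set js"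
    proof (intro allI impI, rule ccontr)
      fix u v assume sib: "siblings G u v" and uv: "u \<noteq> v" "\<not> (u \<in> set js \<or> v \<in> set js)"
      obtain c us where us: "Node c us \<in> subtrees (cotree G)" "Leaf u \<in> fset us" "Leaf v \<in> fset us"
        using sib unfolding siblings_def by blast
      have V: "u \<in> ?V" "v \<in> ?V"
        using siblings_in_pverts[OF G(5) sib] G(2) by simp_all
      obtain \<mu> where \<mu>: "\<And>\<eta>. lap ?E Label1 ?V \<eta> u - lap ?E Label1 ?V \<eta> v = \<mu> * (\<eta> u - \<eta> v)"
        using lap_twins[OF _ V uv(1) E(3)] siblings_twins[OF T(2) us] T(1) by (metis finite_atLeastAtMost)
      \<comment> \<open>The system matrix is minus the Laplacian, hence the rate -\<mu>.\<close>
      have "\<not> controllable ?A ?B"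
      proof (rule uncontrollable_twins[OF A B, of "u - 1" "v - 1" "- \<mu>"])
        show "u - 1 < n" "v - 1 < n" "u - 1 \<noteq> v - 1"
          using V uv(1) by auto
        show "?B $$ (u - 1, k) = 0" "?B $$ (v - 1, k) = 0" if "k < length js" for k
        proof -
          have "w - 1 \<noteq> js ! k - 1" "w - 1 < n" if w: "w \<in> ?V" "w \<notin> set js" for w
          proof -
            have "js ! k \<noteq> w"
              using nth_mem[OF \<open>k < length js\<close>] w(2) by metis
            then show "w - 1 \<noteq> js ! k - 1" "w - 1 < n"
              using w(1) js_nth(1)[OF \<open>k < length js\<close>] unfolding atLeastAtMost_iff by linarith+
          qed
          then show "?B $$ (u - 1, k) = 0" "?B $$ (v - 1, k) = 0"
            using V uv(2) js_nth(2)[OF that] that by (simp_all add: input_matrix_nth)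
        qed
        fix x :: "real vec" assume x: "x \<in> carrier_vec n"
        have "(?A *\<^sub>v x) $ (w - 1) = - lap ?E Label1 ?V (\<lambda>w. x $ (w - 1)) w" if "w \<in> ?V" for w
          using mult_mat_vec_nth[OF A x, of "w - 1"] laplacian_row[OF E(1,2), of "w - 1" "\<lambda>l. x $ l"] that
          by auto
        then show "(?A *\<^sub>v x) $ (u - 1) - (?A *\<^sub>v x) $ (v - 1) = - \<mu> * (x $ (u - 1) - x $ (v - 1))"
          using \<mu>[of "\<lambda>w. x $ (w - 1)"] V by simp
      qed
      then show False
        using ctrl unfolding network_controllable_def by simp
    qed
  next
    assume "\<forall>u v. siblings G u v \<longrightarrow> u \<noteq> v \<longrightarrow> u \<in> set js \<or> v \<in> set js"
    then have cover: "covers (set js) (Node b ts)"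
      using cov root by simp
    define D where "D = (\<lambda>(\<zeta> :: nat \<Rightarrow> real) i. \<Sum>l<n. ?A $$ (l, i) * \<zeta> l)"
    \<comment> \<open>\<open>D\<close> is the transposed system matrix, which by symmetry is again
      minus the Laplacian.\<close>
    have D: "D \<zeta> i = - lap ?E Label1 ?V (\<lambda>w. \<zeta> (w - 1)) (Suc i)" if "i < n" for \<zeta> i
    proof -
      have "D \<zeta> i = (\<Sum>l<n. ?A $$ (i, l) * \<zeta> l)"
        unfolding D_def using laplacian_symmetric[OF E(3) that] laplacian_carrier[of n G] that
        by (intro sum.cong refl) auto
      then show ?thesis
        using laplacian_row[OF E(1,2) that] by simp
    qed
    have D_lin: "(D ^^ k) (\<lambda>i. \<alpha> * \<zeta> i + \<beta> * \<xi> i) = (\<lambda>i. \<alpha> * (D ^^ k) \<zeta> i + \<beta> * (D ^^ k) \<xi> i)"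
      for k \<alpha> \<beta> \<zeta> \<xi>
    proof (induction k)
      case (Suc k)
      then show ?case
        by (simp add: D_def algebra_simps sum.distrib sum_distrib_left)
    qed simp
    have "controllable ?A ?B"
    proof (rule controllable_if_observable[OF A B])
      show "\<exists>i<n. ?B $$ (i, k) \<noteq> 0" if "k < length js" for k
        using that js_nth[OF that] by (intro exI[of _ "js ! k - 1"]) (simp add: input_matrix_nth)
    next
      fix \<eta> :: "nat \<Rightarrow> real"
      assume "\<And>k j. j < length js \<Longrightarrow>
        (\<Sum>i<n. ?B $$ (i, j) * ((\<lambda>\<zeta> i. \<Sum>l<n. ?A $$ (l, i) * \<zeta> l) ^^ k) \<eta> i) = 0"
      then have *: "(\<Sum>i<n. ?B $$ (i, j) * (D ^^ k) \<eta> i) = 0" if "j < length js" for j k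
        using that unfolding D_def by blast
      have obs: "(D ^^ k) \<eta> (w - 1) = 0" if w: "w \<in> set js" for k w
      proof -
        obtain j where j: "j < length js" "js ! j = w"
          using w by (auto simp: in_set_conv_nth)
        have "(\<Sum>i<n. ?B $$ (i, j) * (D ^^ k) \<eta> i) = (\<Sum>i<n. if i = w - 1 then (D ^^ k) \<eta> i else 0)"
          using j js_nth[OF j(1)] by (intro sum.cong refl) (simp add: input_matrix_nth)
        then show ?thesis
          using *[OF j(1), of k] js_nth(2)[OF j(1)] j(2) by simp
      qed
      \<comment> \<open>The unobservable subspace: the vectors whose images under all powers of
        \<open>D\<close> vanish at the control nodes. \<open>W\<close> is the same space seen as
        functions on nodes.\<close>
      define U where "U = {\<zeta>. \<forall>k. \<forall>w\<in>set js. (D ^^ k) \<zeta> (w - 1) = 0}"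
      define W where "W = (\<lambda>\<zeta> w. \<zeta> (w - 1)) ` U"
      have closed: "lap_closed ?E Label1 ?V W"
        unfolding lap_closed_def
      proof (intro ballI allI)
        fix \<theta> \<alpha> \<beta> assume "\<theta> \<in> W"
        then obtain \<zeta> where \<zeta>: "\<zeta> \<in> U" "\<theta> = (\<lambda>w. \<zeta> (w - 1))"
          unfolding W_def by blast
        \<comment> \<open>The sign of \<beta> makes up for \<open>D\<close> being minus the
          Laplacian.\<close>
        let ?\<xi> = "\<lambda>i. \<alpha> * \<zeta> i + (- \<beta>) * D \<zeta> i"
        have "(D ^^ k) (D \<zeta>) (w - 1) = 0" if "w \<in> set js" for k w
          using \<zeta>(1) that unfolding U_def by (metis (mono_tags, lifting) funpow_Suc_right comp_apply mem_Collect_eq)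
        then have "?\<xi> \<in> U"
          using \<zeta>(1) unfolding U_def mem_Collect_eq D_lin by simp
        then have "(\<lambda>w. ?\<xi> (w - 1)) \<in> W"
          unfolding W_def by (rule image_eqI[OF refl])
        moreover have "?\<xi> (u - 1) = \<alpha> * \<theta> u + \<beta> * lap ?E Label1 ?V \<theta> u" if "u \<in> ?V" for u
          using D[of "u - 1" \<zeta>] that \<zeta>(2) by auto
        ultimately show "\<exists>\<theta>'\<in>W. \<forall>u\<in>?V. \<theta>' u = \<alpha> * \<theta> u + \<beta> * lap ?E Label1 ?V \<theta> u"
          by (intro bexI[of _ "\<lambda>w. ?\<xi> (w - 1)"]) blast+
      qed
      have van: "\<forall>\<theta>\<in>W. \<forall>u\<in>?V \<inter> set js. \<theta> u = 0"
      proof (intro ballI)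
        fix \<theta> u assume "\<theta> \<in> W" "u \<in> ?V \<inter> set js"
        then obtain \<zeta> where "\<zeta> \<in> U" "\<theta> u = (D ^^ 0) \<zeta> (u - 1)"
          unfolding W_def by auto
        then show "\<theta> u = 0"
          using \<open>u \<in> ?V \<inter> set js\<close> unfolding U_def mem_Collect_eq by (metis IntD2)
      qed
      have "\<eta> \<in> U"
        using obs by (simp add: U_def)
      then have in_W: "(\<lambda>w. \<eta> (w - 1)) \<in> W"
        unfolding W_def by (rule image_eqI[OF refl])
      show "\<forall>i<n. \<eta> i = 0"
      proof (intro allI impI)
        fix i assume i: "i < n"
        have "\<eta> (Suc i - 1) = 0"
          using T(2)[unfolded root] T(1)[symmetric, unfolded root] E(3) cover _ E(1) closed van in_W
        proof (rule connected_lap_closed_vanishes)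
          fix f :: "nat \<Rightarrow> real" and x y
          assume "\<And>x y. (x, y) \<in> ?E \<Longrightarrow> f x = f y" "x \<in> ?V" "y \<in> ?V"
          then show "f x = f y"
            using arcs_const_if_connected[OF G(4), of f x y] G(2) by blast
        qed (use i in simp)
        then show "\<eta> i = 0" by simp
      qed
    qed
    then show "network_controllable n G js"
      unfolding network_controllable_def .
  qed
qed

section \<open>Counting over the sibling partition\<close>

lemma sibling_equiv:
  assumes "cograph G"
  shows "equiv (pverts G) {(u, v) \<in> pverts G \<times> pverts G. u = v \<or> siblings G u v}"
proof (rule equivI)
  have T: "represents (parcs G) (cotree G)"
    using cotree_is_cotree[OF assms] by (simp add: is_cotree_iff)
  have "siblings G u w" if "siblings G u v" "siblings G v w" for u v w
    using that parent_unique[OF T] unfolding siblings_def by blast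
  then show "trans {(u, v) \<in> pverts G \<times> pverts G. u = v \<or> siblings G u v}"
    by (intro transI) blast
qed (auto simp: refl_on_def sym_def siblings_def)

text \<open>Cells are nonempty, so the bounds \<open>card C - 1\<close> add up to
  \<open>card V - card P\<close> without truncation. If the sums agree, so do the terms, each being
  bounded by its partner.\<close>

lemma partition_on_Diff_le_card_Int:
  assumes P: "partition_on V P" "finite V" and J: "J \<subseteq> V"
    and le: "\<And>C. C \<in> P \<Longrightarrow> card C - 1 \<le> card (J \<inter> C)"
  shows "card V - card P \<le> card J"
    and "card J = card V - card P \<Longrightarrow> C \<in> P \<Longrightarrow> card (J \<inter> C) = card C - 1"
proof -
  have fin: "finite P" "\<And>C. C \<in> P \<Longrightarrow> finite C"
    using P finite_elements[OF P(2,1)] partition_onD1[OF P(1)] by (auto intro: finite_subset)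
  have pos: "1 \<le> card C" if "C \<in> P" for C
    using that fin(2) partition_onD3[OF P(1)] by (metis One_nat_def Suc_leI card_gt_0_iff)
  have J_sum: "(\<Sum>C\<in>P. card (J \<inter> C)) = card J"
  proof -
    have "card (\<Union>C\<in>P. J \<inter> C) = (\<Sum>C\<in>P. card (J \<inter> C))"
      using fin partition_onD2[OF P(1)] unfolding disjoint_def by (intro card_UN_disjoint) auto
    moreover have "(\<Union>C\<in>P. J \<inter> C) = J"
      using J partition_onD1[OF P(1)] by blast
    ultimately show ?thesis by simp
  qed
  have "(\<Sum>C\<in>P. card C - 1) = (\<Sum>C\<in>P. card C) - (\<Sum>C\<in>P. 1)"
    using pos by (rule sum_subtractf_nat)
  then have V_sum: "(\<Sum>C\<in>P. card C - 1) = card V - card P"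
    using product_partition[OF P(1) fin(2)] by simp
  show "card V - card P \<le> card J"
    unfolding V_sum[symmetric] J_sum[symmetric] using le by (rule sum_mono)
  assume eq: "card J = card V - card P" and C: "C \<in> P"
  have "card C - 1 = card (J \<inter> C)"
    using eq le C fin(1) unfolding V_sum[symmetric] J_sum[symmetric]
    by (intro sum_mono_inv[of "\<lambda>C. card C - 1" P "\<lambda>C. card (J \<inter> C)"]) auto
  then show "card (J \<inter> C) = card C - 1" by simp
qed

text \<open>Both sides say that at most one element of \<open>C\<close> lies outside
  \<open>J\<close>; for empty \<open>C\<close> the truncated bound is 0.\<close>

lemma card_Int_ge_iff:
  assumes "finite C"
  shows "card C - 1 \<le> card (J \<inter> C) \<longleftrightarrow> (\<forall>u\<in>C. \<forall>v\<in>C. u \<noteq> v \<longrightarrow> u \<in> J \<or> v \<in> J)"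
proof -
  have "card C = card (J \<inter> C) + card (C - J)"
    using assms card_Int_Diff[of C J] by (simp add: Int_commute)
  then have "card C - 1 \<le> card (J \<inter> C) \<longleftrightarrow> card (C - J) \<le> 1"
    by linarith
  also have "\<dots> \<longleftrightarrow> (\<forall>u\<in>C - J. \<forall>v\<in>C - J. u = v)"
    using assms card_le_Suc0_iff_eq[of "C - J"] by simp
  finally show ?thesis by blast
qed

theorem theorem12:
  fixes n p :: nat and G :: "nat pair_pre_digraph"
  assumes "pair_graph G"
    and "pverts G = {1..n}"
    and "n > 1"
    and "Digraph_Component.connected (with_proj G)"
    and "cograph G"
    and "p = card (sibling_partition G)"
  shows "(\<exists>js. distinct js \<and> set js \<subseteq> {1..n} \<and> network_controllable n G js \<and>
               card (set js) = n - p) \<and>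
         (\<forall>js. set js \<subseteq> {1..n} \<and> network_controllable n G js \<longrightarrow> n - p \<le> card (set js)) \<and>
         (\<forall>js. set js \<subseteq> {1..n} \<and> card (set js) = n - p \<longrightarrow>
               (network_controllable n G js \<longleftrightarrow>
                (\<forall>C\<in>sibling_partition G. card (set js \<inter> C) = card C - 1)))"
proof -
  let ?V = "{1..n}" and ?P = "sibling_partition G"
  define r where "r = {(u, v) \<in> pverts G \<times> pverts G. u = v \<or> siblings G u v}"
  have r_iff: "(u, v) \<in> r \<longleftrightarrow> u \<in> ?V \<and> v \<in> ?V \<and> (u = v \<or> siblings G u v)" for u v
    using assms(2) by (simp add: r_def)
  have r: "equiv ?V r" and P: "?P = ?V // r"
    using sibling_equiv[OF assms(5)] assms(2) by (simp_all add: r_def sibling_partition_def)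
  have part: "partition_on ?V ?P"
    unfolding P by (rule partition_on_quotient[OF r])
  have fin: "finite C" if "C \<in> ?P" for C
    using part that partition_onD1 by (metis Union_upper finite_atLeastAtMost finite_subset)
  have sib_V: "u \<in> ?V \<and> v \<in> ?V" if "siblings G u v" for u v
    using siblings_in_pverts[OF assms(5) that] assms(2) by simp
  have pairs: "(\<exists>C\<in>?P. u \<in> C \<and> v \<in> C) \<longleftrightarrow> (u, v) \<in> r" for u v
  proof
    assume "\<exists>C\<in>?P. u \<in> C \<and> v \<in> C"
    then obtain x where "(x, u) \<in> r" "(x, v) \<in> r"
      unfolding P by (auto elim!: quotientE)
    then show "(u, v) \<in> r"
      using r by (meson equivE symD transD)
  next
    assume uv: "(u, v) \<in> r"
    then have "u \<in> ?V"
      using assms(2) by (simp add: r_def)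
    then show "\<exists>C\<in>?P. u \<in> C \<and> v \<in> C"
      unfolding P using uv equiv_class_self[OF r] by (intro bexI[of _ "r `` {u}"] quotientI) auto
  qed
  have key: "network_controllable n G js \<longleftrightarrow> (\<forall>C\<in>?P. card C - 1 \<le> card (set js \<inter> C))"
    if js: "set js \<subseteq> ?V" for js
  proof -
    have "network_controllable n G js \<longleftrightarrow> (\<forall>u v. (u, v) \<in> r \<longrightarrow> u \<noteq> v \<longrightarrow> u \<in> set js \<or> v \<in> set js)"
      unfolding network_controllable_iff[OF assms(1-5) js] using sib_V unfolding r_iff
      by blast
    also have "\<dots> \<longleftrightarrow> (\<forall>C\<in>?P. \<forall>u\<in>C. \<forall>v\<in>C. u \<noteq> v \<longrightarrow> u \<in> set js \<or> v \<in> set js)"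
      unfolding pairs[symmetric] by blast
    finally show ?thesis
      using card_Int_ge_iff[OF fin] by simp
  qed
  have lower: "n - p \<le> card (set js)" if "set js \<subseteq> ?V" "network_controllable n G js" for js
    using partition_on_Diff_le_card_Int(1)[OF part _ that(1)] key[OF that(1)] that(2) assms(6) by simp
  have exact: "network_controllable n G js \<longleftrightarrow> (\<forall>C\<in>?P. card (set js \<inter> C) = card C - 1)"
    if "set js \<subseteq> ?V" "card (set js) = n - p" for js
    using partition_on_Diff_le_card_Int(2)[OF part _ that(1)] key[OF that(1)] that(2) assms(6) by auto
  have "\<exists>js. distinct js \<and> set js \<subseteq> ?V \<and> network_controllable n G js \<and> card (set js) = n - p"
  proof -
    \<comment> \<open>One arbitrary node per cell is left uncontrolled.\<close>
    define s where "s C = (SOME u. u \<in> C)" for C :: "nat set"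
    have s: "s C \<in> C" if "C \<in> ?P" for C
      unfolding s_def using partition_onD3[OF part] that by (metis ex_in_conv someI_ex)
    have inj: "inj_on s ?P"
      using s partition_onD2[OF part] unfolding inj_on_def disjoint_def by (metis disjoint_iff)
    have sub: "s ` ?P \<subseteq> ?V"
      using s partition_onD1[OF part] by blast
    obtain js where js: "distinct js" "set js = ?V - s ` ?P"
      using finite_distinct_list[of "?V - s ` ?P"] by auto
    have "card (set js) = n - p"
      unfolding js(2) using sub inj assms(6) by (simp add: card_Diff_subset finite_subset card_image)
    moreover have "card C - 1 \<le> card (set js \<inter> C)" if C: "C \<in> ?P" for C
    proof -
      have "u \<in> set js" if u: "u \<in> C" "u \<noteq> s C" for u
      proof -
        have "u \<noteq> s D" if D: "D \<in> ?P" for D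
        proof
          assume "u = s D"
          then have "D = C"
            using disjointD[OF partition_onD2[OF part] C D] s[OF D] u(1) by blast
          then show False
            using u(2) \<open>u = s D\<close> by simp
        qed
        moreover have "u \<in> ?V"
          using u C partition_onD1[OF part] by blast
        ultimately show ?thesis
          using js(2) by blast
      qed
      then show ?thesis
        unfolding card_Int_ge_iff[OF fin[OF C]] by metis
    qed
    ultimately show ?thesis
      using key[of js] js by blast
  qed
  then show ?thesis
    using lower exact by blast
qed

end
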